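(* Every measurable relation algebra $\mathfrak B$ that is completely representable is essentially isomorphic to a group relation algebra; that is, there is a frame $\mathcal F$ such that the completion of $\mathfrak B$ is isomorphic to the group relation algebra $\mathfrak G[\mathcal F]$.
   Context: **Relation algebras.** A relation algebra is an algebra $\mathfrak A=(A,+,-,;,{}^{\smile},1')$ such that $(A,+,-)$ is a Boolean algebra and for all $r,s,t$: $r;(s;t)=(r;s);t$, $r;1'=r$, $r^{\smile\smile}=r$, $(r;s)^\smile=s^\smile;r^\smile$, $(r+s);t=r;t+s;t$, $(r+s)^\smile=r^\smile+s^\smile$, $r^\smile;-(r;s)+-s=-s$. Order, $0$, $1$, suprema, atoms, completeness refer to the Boolean part. A function is an element $f$ with $f^\smile;f\le 1'$. A subidentity atom is an atom $x\le 1'$; it is measurable if $x;1;x$ is the sum (supremum) of a set of functions. A relation algebra is measurable if $1'$ is the sum of a set of measurable atoms. The completion of $\mathfrak B$ is its minimal complete extension: the (unique up to isomorphism over $\mathfrak B$) complete relation algebra having $\mathfrak B$ as a subalgebra and whose Boolean part is the Boolean completion of that of $\mathfrak B$. **Complete representations.** A complete representation of a relation algebra $\mathfrak A$ is an embedding $\vartheta$ of $\mathfrak A$ into the set relation algebra of all subrelations of some equivalence relation $E$ on a set $U$ (operations: union, complement relative to $E$, relational composition, relational converse, and the identity relation $id_U$; the unit is $E$) that preserves all existing suprema as unions: whenever $a=\sum X$ exists in $\mathfrak A$, $\vartheta(a)=\bigcup\{\vartheta(b):b\in X\}$. $\mathfrak A$ is completely representable if it has a complete representation. **Frames.** A group pair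 $\mathcal F=(G,\varphi)$ consists of a system $G=\langle G_x:x\in I\rangle$ of pairwise disjoint groups and a system $\varphi=\langle\varphi_{xy}:(x,y)\in\mathcal E\rangle$, where $\mathcal E$ is an equivalence relation on $I$ and $\varphi_{xy}$ is an isomorphism from $G_x/H_{xy}$ to $G_y/K_{xy}$ ($H_{xy},K_{xy}$ normal subgroups of $G_x,G_y$). For a union $N$ of cosets of $H_{xy}$, $\varphi_{xy}[N]$ is the union of the images of the cosets of $H_{xy}$ included in $N$. The pair is a frame if: (i) $\varphi_{xx}$ is the identity automorphism of $G_x/\{e_x\}$ ($e_x$ the identity of $G_x$) for all $x\in I$; (ii) $\varphi_{yx}=\varphi_{xy}^{-1}$ for $(x,y)\in\mathcal E$; and whenever $(x,y),(y,z)\in\mathcal E$: (iii) $\varphi_{xy}[H_{xy}H_{xz}]=K_{xy}H_{yz}$; (iv) $\hat\varphi_{xy}|\hat\varphi_{yz}=\hat\varphi_{xz}$, where $|$ is composition applying the left map first and $\hat\varphi_{xy}:G_x/(H_{xy}H_{xz})\to G_y/(K_{xy}H_{yz})$, $\hat\varphi_{yz}:G_y/(K_{xy}H_{yz})\to G_z/(K_{xz}K_{yz})$, $\hat\varphi_{xz}:G_x/(H_{xy}H_{xz})\to G_z/(K_{xz}K_{yz})$ are the induced isomorphisms. **Group relation algebras.** For a frame $\mathcal F$ put $U=\bigcup_{x\in I}G_x$, $E=\bigcup\{G_x\times G_y:(x,y)\in\mathcal E\}$, and for $(x,y)\in\mathcal E$ and $\alpha\in G_x/H_{xy}$, $$R_{xy,\alpha}=\bigcup\{\xi\times(\varphi_{xy}(\xi)\varphi_{xy}(\alpha)):\xi\in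 G_x/H_{xy}\}.$$ The group relation algebra $\mathfrak G[\mathcal F]$ on $\mathcal F$ is the algebra whose universe is the set of all unions of sets of relations $R_{xy,\alpha}$, with operations set-theoretic union, complement relative to the unit $E$, relational composition, relational converse, and $id_U$ as identity element. (It is a complete set relation algebra.) *)

theory Defs
  imports "HOL-Algebra.Coset" "HOL-Library.Disjoint_Sets"
begin

section \<open>Relation algebras\<close>

record 'a rel_alg = "'a partial_object" +
  radd  :: "'a \<Rightarrow> 'a \<Rightarrow> 'a"  (infixl "\<^bold>+\<index>" 65)
  rneg  :: "'a \<Rightarrow> 'a"  ("\<^bold>-\<index> _" [81] 80)
  rcomp :: "'a \<Rightarrow> 'a \<Rightarrow> 'a"  (infixl "\<^bold>;\<index>" 70)
  rconv :: "'a \<Rightarrow> 'a"  ("_\<^sup>\<smile>\<index>" [1000] 999)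
  rid   :: "'a"  ("\<^bold>1''\<index>")

text \<open>
  The signature contains only the operations \<open>+\<close> and \<open>-\<close> on the Boolean side, so meet, unit,
  zero and order are derived.
\<close>

definition rmeet :: "_ \<Rightarrow> 'a \<Rightarrow> 'a \<Rightarrow> 'a"  (infixl "\<^bold>\<cdot>\<index>" 68)
  where "a \<^bold>\<cdot>\<^bsub>A\<^esub> b = \<^bold>-\<^bsub>A\<^esub> (\<^bold>-\<^bsub>A\<^esub> a \<^bold>+\<^bsub>A\<^esub> \<^bold>-\<^bsub>A\<^esub> b)"

definition runit :: "_ \<Rightarrow> 'a"  ("\<^bold>1\<index>")
  where "\<^bold>1\<^bsub>A\<^esub> = \<^bold>1'\<^bsub>A\<^esub> \<^bold>+\<^bsub>A\<^esub> \<^bold>-\<^bsub>A\<^esub> \<^bold>1'\<^bsub>A\<^esub>"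

definition rzero :: "_ \<Rightarrow> 'a"  ("\<^bold>0\<index>")
  where "\<^bold>0\<^bsub>A\<^esub> = \<^bold>-\<^bsub>A\<^esub> \<^bold>1\<^bsub>A\<^esub>"

definition ra_order :: "('a, 'm) rel_alg_scheme \<Rightarrow> 'a gorder"
  where "ra_order A = \<lparr>carrier = carrier A, eq = (=), le = (\<lambda>a b. a \<^bold>+\<^bsub>A\<^esub> b = b)\<rparr>"

abbreviation rle :: "_ \<Rightarrow> 'a \<Rightarrow> 'a \<Rightarrow> bool"  (infixl "\<^bold>\<le>\<index>" 50)
  where "a \<^bold>\<le>\<^bsub>A\<^esub> b \<equiv> a \<sqsubseteq>\<^bsub>ra_order A\<^esub> b"

text \<open>The supremum of \<open>X\<close> exists and is \<open>s\<close>.\<close>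

abbreviation is_sum :: "('a, 'm) rel_alg_scheme \<Rightarrow> 'a \<Rightarrow> 'a set \<Rightarrow> bool"
  where "is_sum A s X \<equiv> is_lub (ra_order A) s X"

locale relation_algebra =
  fixes A (structure)
  assumes add_closed: "\<lbrakk>r \<in> carrier A; s \<in> carrier A\<rbrakk> \<Longrightarrow> r \<^bold>+ s \<in> carrier A"
    and neg_closed: "r \<in> carrier A \<Longrightarrow> \<^bold>- r \<in> carrier A"
    and comp_closed: "\<lbrakk>r \<in> carrier A; s \<in> carrier A\<rbrakk> \<Longrightarrow> r \<^bold>; s \<in> carrier A"
    and conv_closed: "r \<in> carrier A \<Longrightarrow> r\<^sup>\<smile> \<in> carrier A"
    and id_closed: "\<^bold>1' \<in> carrier A"
    \<comment> \<open>\<open>(A, +, -)\<close> is a Boolean algebra (cf. locale \<^locale>\<open>abstract_boolean_algebra\<close>)\<close>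
    and add_assoc:
      "\<lbrakk>r \<in> carrier A; s \<in> carrier A; t \<in> carrier A\<rbrakk> \<Longrightarrow> (r \<^bold>+ s) \<^bold>+ t = r \<^bold>+ (s \<^bold>+ t)"
    and meet_assoc:
      "\<lbrakk>r \<in> carrier A; s \<in> carrier A; t \<in> carrier A\<rbrakk> \<Longrightarrow> (r \<^bold>\<cdot> s) \<^bold>\<cdot> t = r \<^bold>\<cdot> (s \<^bold>\<cdot> t)"
    and add_commute: "\<lbrakk>r \<in> carrier A; s \<in> carrier A\<rbrakk> \<Longrightarrow> r \<^bold>+ s = s \<^bold>+ r"
    and meet_commute: "\<lbrakk>r \<in> carrier A; s \<in> carrier A\<rbrakk> \<Longrightarrow> r \<^bold>\<cdot> s = s \<^bold>\<cdot> r"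
    and meet_add_distrib:
      "\<lbrakk>r \<in> carrier A; s \<in> carrier A; t \<in> carrier A\<rbrakk> \<Longrightarrow> r \<^bold>\<cdot> (s \<^bold>+ t) = (r \<^bold>\<cdot> s) \<^bold>+ (r \<^bold>\<cdot> t)"
    and add_meet_distrib:
      "\<lbrakk>r \<in> carrier A; s \<in> carrier A; t \<in> carrier A\<rbrakk> \<Longrightarrow> r \<^bold>+ (s \<^bold>\<cdot> t) = (r \<^bold>+ s) \<^bold>\<cdot> (r \<^bold>+ t)"
    and meet_unit: "r \<in> carrier A \<Longrightarrow> r \<^bold>\<cdot> \<^bold>1 = r"
    and add_zero: "r \<in> carrier A \<Longrightarrow> r \<^bold>+ \<^bold>0 = r"
    and meet_neg: "r \<in> carrier A \<Longrightarrow> r \<^bold>\<cdot> \<^bold>- r = \<^bold>0"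
    and add_neg: "r \<in> carrier A \<Longrightarrow> r \<^bold>+ \<^bold>- r = \<^bold>1"
    \<comment> \<open>the relational axioms\<close>
    and comp_assoc:
      "\<lbrakk>r \<in> carrier A; s \<in> carrier A; t \<in> carrier A\<rbrakk> \<Longrightarrow> r \<^bold>; (s \<^bold>; t) = (r \<^bold>; s) \<^bold>; t"
    and comp_id: "r \<in> carrier A \<Longrightarrow> r \<^bold>; \<^bold>1' = r"
    and conv_conv: "r \<in> carrier A \<Longrightarrow> (r\<^sup>\<smile>)\<^sup>\<smile> = r"
    and conv_comp: "\<lbrakk>r \<in> carrier A; s \<in> carrier A\<rbrakk> \<Longrightarrow> (r \<^bold>; s)\<^sup>\<smile> = s\<^sup>\<smile> \<^bold>; r\<^sup>\<smile>"
    and comp_add_distrib: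
      "\<lbrakk>r \<in> carrier A; s \<in> carrier A; t \<in> carrier A\<rbrakk> \<Longrightarrow> (r \<^bold>+ s) \<^bold>; t = (r \<^bold>; t) \<^bold>+ (s \<^bold>; t)"
    and conv_add: "\<lbrakk>r \<in> carrier A; s \<in> carrier A\<rbrakk> \<Longrightarrow> (r \<^bold>+ s)\<^sup>\<smile> = r\<^sup>\<smile> \<^bold>+ s\<^sup>\<smile>"
    and tarski:
      "\<lbrakk>r \<in> carrier A; s \<in> carrier A\<rbrakk> \<Longrightarrow> (r\<^sup>\<smile> \<^bold>; \<^bold>- (r \<^bold>; s)) \<^bold>+ \<^bold>- s = \<^bold>- s"


section \<open>Homomorphisms\<close>

definition ra_hom :: "('a, 'm) rel_alg_scheme \<Rightarrow> ('b, 'n) rel_alg_scheme \<Rightarrow> ('a \<Rightarrow> 'b) set"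
  where "ra_hom A B = {h. h \<in> carrier A \<rightarrow> carrier B
    \<and> (\<forall>a\<in>carrier A. \<forall>b\<in>carrier A. h (a \<^bold>+\<^bsub>A\<^esub> b) = h a \<^bold>+\<^bsub>B\<^esub> h b)
    \<and> (\<forall>a\<in>carrier A. h (\<^bold>-\<^bsub>A\<^esub> a) = \<^bold>-\<^bsub>B\<^esub> h a)
    \<and> (\<forall>a\<in>carrier A. \<forall>b\<in>carrier A. h (a \<^bold>;\<^bsub>A\<^esub> b) = h a \<^bold>;\<^bsub>B\<^esub> h b)
    \<and> (\<forall>a\<in>carrier A. h (a\<^sup>\<smile>\<^bsub>A\<^esub>) = (h a)\<^sup>\<smile>\<^bsub>B\<^esub>)
    \<and> h \<^bold>1'\<^bsub>A\<^esub> = \<^bold>1'\<^bsub>B\<^esub>}"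

definition ra_embedding :: "('a, 'm) rel_alg_scheme \<Rightarrow> ('b, 'n) rel_alg_scheme \<Rightarrow> ('a \<Rightarrow> 'b) set"
  where "ra_embedding A B = {h \<in> ra_hom A B. inj_on h (carrier A)}"

definition ra_isomorphic :: "('a, 'm) rel_alg_scheme \<Rightarrow> ('b, 'n) rel_alg_scheme \<Rightarrow> bool"
  where "ra_isomorphic A B \<longleftrightarrow> (\<exists>h \<in> ra_hom A B. bij_betw h (carrier A) (carrier B))"


section \<open>Measurable relation algebras\<close>

definition ra_function :: "('a, 'm) rel_alg_scheme \<Rightarrow> 'a \<Rightarrow> bool"
  where "ra_function A f \<longleftrightarrow> f \<in> carrier A \<and> f\<^sup>\<smile>\<^bsub>A\<^esub> \<^bold>;\<^bsub>A\<^esub> f \<^bold>\<le>\<^bsub>A\<^esub> \<^bold>1'\<^bsub>A\<^esub>"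

definition ra_atom :: "('a, 'm) rel_alg_scheme \<Rightarrow> 'a \<Rightarrow> bool"
  where "ra_atom A a \<longleftrightarrow> a \<in> carrier A \<and> a \<noteq> \<^bold>0\<^bsub>A\<^esub>
    \<and> (\<forall>b\<in>carrier A. b \<^bold>\<le>\<^bsub>A\<^esub> a \<longrightarrow> b = \<^bold>0\<^bsub>A\<^esub> \<or> b = a)"

definition measurable_atom :: "('a, 'm) rel_alg_scheme \<Rightarrow> 'a \<Rightarrow> bool"
  where "measurable_atom A x \<longleftrightarrow> ra_atom A x \<and> x \<^bold>\<le>\<^bsub>A\<^esub> \<^bold>1'\<^bsub>A\<^esub>
    \<and> (\<exists>X \<subseteq> {f. ra_function A f}. is_sum A (x \<^bold>;\<^bsub>A\<^esub> \<^bold>1\<^bsub>A\<^esub> \<^bold>;\<^bsub>A\<^esub> x) X)"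

definition measurable_rel_alg :: "('a, 'm) rel_alg_scheme \<Rightarrow> bool"
  where "measurable_rel_alg A \<longleftrightarrow> relation_algebra A
    \<and> (\<exists>X \<subseteq> {x. measurable_atom A x}. is_sum A \<^bold>1'\<^bsub>A\<^esub> X)"


section \<open>Completions\<close>

definition complete_rel_alg :: "('a, 'm) rel_alg_scheme \<Rightarrow> bool"
  where "complete_rel_alg A \<longleftrightarrow> relation_algebra A \<and> complete_lattice (ra_order A)"

text \<open>
  \<open>C\<close> is a completion of \<open>B\<close>, up to renaming the elements of \<open>B\<close> along an embedding \<open>e\<close>.  The
  last conjunct says that \<open>B\<close> is dense in \<open>C\<close>: a Boolean completion is a complete extension in
  which the original algebra is dense.
\<close>

definition is_completion :: "('a, 'm) rel_alg_scheme \<Rightarrow> ('c, 'n) rel_alg_scheme \<Rightarrow> bool"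
  where "is_completion B C \<longleftrightarrow> complete_rel_alg C
    \<and> (\<exists>e \<in> ra_embedding B C.
        \<forall>c\<in>carrier C. c \<noteq> \<^bold>0\<^bsub>C\<^esub> \<longrightarrow> (\<exists>b\<in>carrier B. e b \<noteq> \<^bold>0\<^bsub>C\<^esub> \<and> e b \<^bold>\<le>\<^bsub>C\<^esub> c))"


section \<open>Complete representations\<close>

definition full_set_rel_alg :: "'u set \<Rightarrow> 'u rel \<Rightarrow> 'u rel rel_alg"
  where "full_set_rel_alg U E =
    \<lparr>carrier = Pow E, radd = (\<union>), rneg = (\<lambda>R. E - R), rcomp = (O), rconv = converse, rid = Id_on U\<rparr>"

definition complete_representation ::
    "('a, 'm) rel_alg_scheme \<Rightarrow> 'u set \<Rightarrow> 'u rel \<Rightarrow> ('a \<Rightarrow> 'u rel) \<Rightarrow> bool"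
  where "complete_representation A U E \<theta> \<longleftrightarrow> equiv U E
    \<and> \<theta> \<in> ra_embedding A (full_set_rel_alg U E)
    \<and> (\<forall>X a. X \<subseteq> carrier A \<longrightarrow> is_sum A a X \<longrightarrow> \<theta> a = (\<Union>b\<in>X. \<theta> b))"


section \<open>Group frames\<close>

text \<open>
  A group pair, with the normal subgroups \<open>H\<^sub>x\<^sub>y\<close>, \<open>K\<^sub>x\<^sub>y\<close> (part of the data of \<open>\<phi>\<^sub>x\<^sub>y\<close>) made
  explicit.  Values at indices outside \<open>I\<close> or pairs outside \<open>\<E>\<close> are irrelevant.
\<close>

record ('i, 'g) group_pair =
  idx :: "'i set"
  ieq :: "'i rel"
  grp :: "'i \<Rightarrow> 'g monoid"
  Hsub :: "'i \<Rightarrow> 'i \<Rightarrow> 'g set"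
  Ksub :: "'i \<Rightarrow> 'i \<Rightarrow> 'g set"
  quot_iso :: "'i \<Rightarrow> 'i \<Rightarrow> 'g set \<Rightarrow> 'g set"

definition is_group_pair :: "('i, 'g) group_pair \<Rightarrow> bool"
  where "is_group_pair F \<longleftrightarrow>
    (\<forall>x\<in>idx F. group (grp F x))
    \<and> disjoint_family_on (\<lambda>x. carrier (grp F x)) (idx F)
    \<and> equiv (idx F) (ieq F)
    \<and> (\<forall>(x, y) \<in> ieq F.
        Hsub F x y \<lhd> grp F x \<and> Ksub F x y \<lhd> grp F y
        \<and> quot_iso F x y \<in> iso (grp F x Mod Hsub F x y) (grp F y Mod Ksub F x y))"

text \<open>
  \<open>\<phi>\<^sub>x\<^sub>y[N]\<close> for a union \<open>N\<close> of cosets of \<open>H\<^sub>x\<^sub>y\<close>.  Restricted to the cosets of a normal subgroup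
  containing \<open>H\<^sub>x\<^sub>y\<close>, this map is the isomorphism of quotients induced by \<open>\<phi>\<^sub>x\<^sub>y\<close>.
\<close>

definition quot_image :: "('i, 'g) group_pair \<Rightarrow> 'i \<Rightarrow> 'i \<Rightarrow> 'g set \<Rightarrow> 'g set"
  where "quot_image F x y N =
    \<Union> {quot_iso F x y \<xi> | \<xi>. \<xi> \<in> carrier (grp F x Mod Hsub F x y) \<and> \<xi> \<subseteq> N}"

definition is_frame :: "('i, 'g) group_pair \<Rightarrow> bool"
  where "is_frame F \<longleftrightarrow> is_group_pair F
    \<and> (\<forall>x\<in>idx F.
        Hsub F x x = {\<one>\<^bsub>grp F x\<^esub>} \<and> Ksub F x x = {\<one>\<^bsub>grp F x\<^esub>}
        \<and> (\<forall>\<xi> \<in> carrier (grp F x Mod {\<one>\<^bsub>grp F x\<^esub>}). quot_iso F x x \<xi> = \<xi>))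
    \<and> (\<forall>(x, y) \<in> ieq F.
        Hsub F y x = Ksub F x y \<and> Ksub F y x = Hsub F x y
        \<and> (\<forall>\<xi> \<in> carrier (grp F y Mod Ksub F x y).
            quot_iso F y x \<xi> = inv_into (carrier (grp F x Mod Hsub F x y)) (quot_iso F x y) \<xi>))
    \<and> (\<forall>x y z. (x, y) \<in> ieq F \<longrightarrow> (y, z) \<in> ieq F \<longrightarrow>
        quot_image F x y (Hsub F x y <#>\<^bsub>grp F x\<^esub> Hsub F x z)
          = Ksub F x y <#>\<^bsub>grp F y\<^esub> Hsub F y z
        \<and> (\<forall>N \<in> carrier (grp F x Mod (Hsub F x y <#>\<^bsub>grp F x\<^esub> Hsub F x z)).
            quot_image F y z (quot_image F x y N) = quot_image F x z N))"


section \<open>Group relation algebras\<close>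

definition frame_base :: "('i, 'g) group_pair \<Rightarrow> 'g set"
  where "frame_base F = (\<Union>x\<in>idx F. carrier (grp F x))"

definition frame_unit :: "('i, 'g) group_pair \<Rightarrow> 'g rel"
  where "frame_unit F = (\<Union>(x, y)\<in>ieq F. carrier (grp F x) \<times> carrier (grp F y))"

definition frame_rel :: "('i, 'g) group_pair \<Rightarrow> 'i \<Rightarrow> 'i \<Rightarrow> 'g set \<Rightarrow> 'g rel"
  where "frame_rel F x y \<alpha> =
    (\<Union>\<xi> \<in> carrier (grp F x Mod Hsub F x y).
      \<xi> \<times> (quot_iso F x y \<xi> <#>\<^bsub>grp F y\<^esub> quot_iso F x y \<alpha>))"

definition group_rel_alg :: "('i, 'g) group_pair \<Rightarrow> 'g rel rel_alg"
  where "group_rel_alg F =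
    \<lparr>carrier = {\<Union> S | S. S \<subseteq> {frame_rel F x y \<alpha> | x y \<alpha>.
        (x, y) \<in> ieq F \<and> \<alpha> \<in> carrier (grp F x Mod Hsub F x y)}},
     radd = (\<union>), rneg = (\<lambda>R. frame_unit F - R), rcomp = (O), rconv = converse,
     rid = Id_on (frame_base F)\<rparr>"

end

theory Submission
  imports Defs "HOL-Algebra.Zassenhaus"
begin

text \<open>
  A complete representation over \<open>U\<close> puts every pair of related points into an atom.  For a measurable
  atom \<open>x\<close> let \<open>U\<^sub>x \<subseteq> U\<close> be the set of points of \<open>x\<close>; every atom below \<open>x;1;x\<close> is represented by a
  permutation of \<open>U\<^sub>x\<close>, and these atoms form a group \<open>G\<^sub>x\<close> acting freely on \<open>U\<^sub>x\<close>, transitively on each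
  class.  Choose base points \<open>b\<^sub>x \<in> U\<^sub>x\<close> that are related to each other whenever \<open>x;1;y\<close> is nonzero; then
  \<open>f \<mapsto> f b\<^sub>x\<close> identifies the disjoint union of the \<open>G\<^sub>x\<close> with a union of classes that still represents the
  algebra faithfully.  The atom \<open>a\<close> through \<open>(b\<^sub>x, b\<^sub>y)\<close> becomes the subdirect subgroup
  \<open>S\<^sub>x\<^sub>y = {(f, g). f;a = a;g}\<close> of \<open>G\<^sub>x \<times> G\<^sub>y\<close>, and Goursat's lemma turns it into an isomorphism \<open>\<phi>\<^sub>x\<^sub>y\<close>
  of quotients.  The frame conditions come from \<open>S\<^sub>y\<^sub>x = S\<^sub>x\<^sub>y\<^sup>-\<^sup>1\<close> and \<open>S\<^sub>x\<^sub>z \<subseteq> S\<^sub>x\<^sub>y | S\<^sub>y\<^sub>z\<close>, and the relation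
  \<open>R\<^sub>x\<^sub>y\<^sub>,\<^sub>\<alpha>\<close> for the coset \<open>\<alpha>\<close> of \<open>h\<close> is the image of the atom \<open>h;a\<close>.  Any completion of an atomic
  algebra is determined by its atoms, hence is the group relation algebra.
\<close>


section \<open>Arithmetic of relation algebras\<close>

lemma rle_iff: "a \<^bold>\<le>\<^bsub>A\<^esub> b \<longleftrightarrow> a \<^bold>+\<^bsub>A\<^esub> b = b"
  by (simp add: ra_order_def)

lemma ra_order_carrier [simp]: "carrier (ra_order A) = carrier A"
  by (simp add: ra_order_def)

lemma is_sum_iff:
  "is_sum A s X \<longleftrightarrow> s \<in> carrier A \<and> (\<forall>b\<in>X \<inter> carrier A. b \<^bold>\<le>\<^bsub>A\<^esub> s)
    \<and> (\<forall>c\<in>carrier A. (\<forall>b\<in>X \<inter> carrier A. b \<^bold>\<le>\<^bsub>A\<^esub> c) \<longrightarrow> s \<^bold>\<le>\<^bsub>A\<^esub> c)"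
  if "X \<subseteq> carrier A"
  using that by (auto simp: least_def Upper_def)

context relation_algebra
begin

section \<open>Boolean laws and the order\<close>

lemma unit_closed [simp]: "\<^bold>1 \<in> carrier A"
  by (simp add: runit_def add_closed neg_closed id_closed)

lemma zero_closed [simp]: "\<^bold>0 \<in> carrier A"
  by (simp add: rzero_def neg_closed)

lemma meet_closed [simp]: "\<lbrakk>r \<in> carrier A; s \<in> carrier A\<rbrakk> \<Longrightarrow> r \<^bold>\<cdot> s \<in> carrier A"
  by (simp add: rmeet_def add_closed neg_closed)

declare add_closed [simp] neg_closed [simp] comp_closed [simp] conv_closed [simp] id_closed [simp]

lemma add_idem: "r \<in> carrier A \<Longrightarrow> r \<^bold>+ r = r"
proof -
  assume r: "r \<in> carrier A"
  have "r = r \<^bold>+ r \<^bold>\<cdot> \<^bold>- r" using r by (simp add: meet_neg add_zero)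
  also have "\<dots> = r \<^bold>+ r" using r by (simp add: add_meet_distrib add_neg meet_unit)
  finally show ?thesis by simp
qed

text \<open>Meet is defined from join and complement by De Morgan, so the meet of \<open>r\<close>
  with itself unfolds to the double complement of \<open>r\<close> once join is idempotent; the
  axioms for meet show that it is \<open>r\<close> as well.\<close>

lemma neg_neg: "r \<in> carrier A \<Longrightarrow> \<^bold>- (\<^bold>- r) = r"
proof -
  assume r: "r \<in> carrier A"
  have "r = r \<^bold>\<cdot> (r \<^bold>+ \<^bold>- r)" using r by (simp add: add_neg meet_unit)
  also have "\<dots> = r \<^bold>\<cdot> r" using r by (simp add: meet_add_distrib meet_neg add_zero)
  also have "\<dots> = \<^bold>- (\<^bold>- r)" using r by (simp add: rmeet_def add_idem)
  finally show ?thesis by simp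
qed

lemma meet_zero: "r \<in> carrier A \<Longrightarrow> r \<^bold>\<cdot> \<^bold>0 = \<^bold>0"
proof -
  assume r: "r \<in> carrier A"
  have "r \<^bold>\<cdot> \<^bold>0 = r \<^bold>\<cdot> \<^bold>0 \<^bold>+ r \<^bold>\<cdot> \<^bold>- r" using r by (simp add: meet_neg add_zero)
  also have "\<dots> = r \<^bold>\<cdot> (\<^bold>0 \<^bold>+ \<^bold>- r)" using r by (simp add: meet_add_distrib)
  also have "\<dots> = \<^bold>0" using r by (simp add: add_commute[of "\<^bold>0"] add_zero meet_neg)
  finally show ?thesis .
qed

lemma absorb: "\<lbrakk>r \<in> carrier A; s \<in> carrier A\<rbrakk> \<Longrightarrow> r \<^bold>\<cdot> (r \<^bold>+ s) = r"
proof -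
  assume r: "r \<in> carrier A" "s \<in> carrier A"
  have "r \<^bold>\<cdot> (r \<^bold>+ s) = (r \<^bold>+ \<^bold>0) \<^bold>\<cdot> (r \<^bold>+ s)" using r by (simp add: add_zero)
  also have "\<dots> = r \<^bold>+ s \<^bold>\<cdot> \<^bold>0" using r by (simp add: meet_commute flip: add_meet_distrib)
  also have "\<dots> = r" using r by (simp add: meet_zero add_zero)
  finally show ?thesis .
qed

lemma absorb2: "\<lbrakk>r \<in> carrier A; s \<in> carrier A\<rbrakk> \<Longrightarrow> r \<^bold>+ r \<^bold>\<cdot> s = r"
  by (simp add: add_meet_distrib add_idem absorb)

lemma le_refl: "r \<in> carrier A \<Longrightarrow> r \<^bold>\<le> r"
  by (simp add: rle_iff add_idem)

lemma le_trans:
  "\<lbrakk>r \<^bold>\<le> s; s \<^bold>\<le> t; r \<in> carrier A; s \<in> carrier A; t \<in> carrier A\<rbrakk> \<Longrightarrow> r \<^bold>\<le> t"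
  unfolding rle_iff by (metis add_assoc)

lemma le_antisym: "\<lbrakk>r \<^bold>\<le> s; s \<^bold>\<le> r; r \<in> carrier A; s \<in> carrier A\<rbrakk> \<Longrightarrow> r = s"
  unfolding rle_iff by (metis add_commute)

lemma zero_le: "r \<in> carrier A \<Longrightarrow> \<^bold>0 \<^bold>\<le> r"
  unfolding rle_iff by (metis add_commute add_zero zero_closed)

lemma le_add1: "\<lbrakk>r \<in> carrier A; s \<in> carrier A\<rbrakk> \<Longrightarrow> r \<^bold>\<le> r \<^bold>+ s"
  unfolding rle_iff by (metis add_assoc add_idem)

lemma le_add2: "\<lbrakk>r \<in> carrier A; s \<in> carrier A\<rbrakk> \<Longrightarrow> s \<^bold>\<le> r \<^bold>+ s"
  by (metis le_add1 add_commute)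

lemma le_iff_meet: "\<lbrakk>r \<in> carrier A; s \<in> carrier A\<rbrakk> \<Longrightarrow> r \<^bold>\<le> s \<longleftrightarrow> r \<^bold>\<cdot> s = r"
  unfolding rle_iff
  using absorb[of r s] absorb2[of s r] by (auto simp: meet_commute[of r s] add_commute)

lemma meet_le1: "\<lbrakk>r \<in> carrier A; s \<in> carrier A\<rbrakk> \<Longrightarrow> r \<^bold>\<cdot> s \<^bold>\<le> r"
  unfolding rle_iff by (metis absorb2 add_commute meet_closed)

lemma meet_le2: "\<lbrakk>r \<in> carrier A; s \<in> carrier A\<rbrakk> \<Longrightarrow> r \<^bold>\<cdot> s \<^bold>\<le> s"
  by (metis meet_le1 meet_commute)

lemma le_iff_meet_neg:
  assumes "r \<in> carrier A" "s \<in> carrier A"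
  shows "r \<^bold>\<le> s \<longleftrightarrow> r \<^bold>\<cdot> \<^bold>- s = \<^bold>0"
proof
  assume "r \<^bold>\<le> s"
  then show "r \<^bold>\<cdot> \<^bold>- s = \<^bold>0"
    using assms by (metis le_iff_meet meet_assoc meet_neg meet_zero neg_closed)
next
  assume "r \<^bold>\<cdot> \<^bold>- s = \<^bold>0"
  then have "r = r \<^bold>\<cdot> s"
    using assms by (metis add_neg add_zero meet_add_distrib meet_closed meet_unit neg_closed)
  then show "r \<^bold>\<le> s"
    using assms le_iff_meet by metis
qed

lemma neg_anti:
  assumes "r \<^bold>\<le> s" "r \<in> carrier A" "s \<in> carrier A"
  shows "\<^bold>- s \<^bold>\<le> \<^bold>- r"
  using assms le_iff_meet_neg[of r s] le_iff_meet_neg[of "\<^bold>- s" "\<^bold>- r"]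
  by (simp add: neg_neg meet_commute)

lemma meet_eq_zero_iff:
  "\<lbrakk>r \<in> carrier A; s \<in> carrier A\<rbrakk> \<Longrightarrow> r \<^bold>\<cdot> s = \<^bold>0 \<longleftrightarrow> r \<^bold>\<le> \<^bold>- s"
  by (simp add: le_iff_meet_neg neg_neg)

section \<open>Monotonicity, cycle laws and converse\<close>

lemma conv_mono:
  "\<lbrakk>r \<^bold>\<le> s; r \<in> carrier A; s \<in> carrier A\<rbrakk> \<Longrightarrow> r\<^sup>\<smile> \<^bold>\<le> s\<^sup>\<smile>"
  unfolding rle_iff by (metis conv_add)

lemma conv_le_iff:
  "\<lbrakk>r \<in> carrier A; s \<in> carrier A\<rbrakk> \<Longrightarrow> r\<^sup>\<smile> \<^bold>\<le> s \<longleftrightarrow> r \<^bold>\<le> s\<^sup>\<smile>"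
  using conv_mono[of "r\<^sup>\<smile>" s] conv_mono[of r "s\<^sup>\<smile>"] by (auto simp: conv_conv)

lemma comp_mono1:
  "\<lbrakk>r \<^bold>\<le> s; r \<in> carrier A; s \<in> carrier A; t \<in> carrier A\<rbrakk> \<Longrightarrow> r \<^bold>; t \<^bold>\<le> s \<^bold>; t"
  unfolding rle_iff by (metis comp_add_distrib)

lemma comp_mono2:
  assumes "r \<^bold>\<le> s" "r \<in> carrier A" "s \<in> carrier A" "t \<in> carrier A"
  shows "t \<^bold>; r \<^bold>\<le> t \<^bold>; s"
proof -
  have "(r\<^sup>\<smile> \<^bold>; t\<^sup>\<smile>)\<^sup>\<smile> \<^bold>\<le> (s\<^sup>\<smile> \<^bold>; t\<^sup>\<smile>)\<^sup>\<smile>"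
    using assms by (intro conv_mono comp_mono1) auto
  then show ?thesis
    using assms by (simp add: conv_comp conv_conv)
qed

lemma comp_mono:
  assumes "r \<^bold>\<le> s" "t \<^bold>\<le> q" "r \<in> carrier A" "s \<in> carrier A" "t \<in> carrier A" "q \<in> carrier A"
  shows "r \<^bold>; t \<^bold>\<le> s \<^bold>; q"
  using le_trans[OF comp_mono1[OF assms(1)] comp_mono2[OF assms(2)]] assms by simp

text \<open>This is the Tarski axiom read as an implication: the hypothesis puts \<open>t\<close>
  below the complement of \<open>r;s\<close>, and the axiom bounds the product of the converse of
  \<open>r\<close> with that complement.\<close>

lemma cycle1:
  assumes "r \<^bold>; s \<^bold>\<le> \<^bold>- t" "r \<in> carrier A" "s \<in> carrier A" "t \<in> carrier A"
  shows "r\<^sup>\<smile> \<^bold>; t \<^bold>\<le> \<^bold>- s"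
proof -
  have "t \<^bold>\<le> \<^bold>- (r \<^bold>; s)"
    using neg_anti[OF assms(1)] assms by (simp add: neg_neg)
  then have "r\<^sup>\<smile> \<^bold>; t \<^bold>\<le> r\<^sup>\<smile> \<^bold>; \<^bold>- (r \<^bold>; s)"
    using assms by (intro comp_mono2) auto
  moreover have "r\<^sup>\<smile> \<^bold>; \<^bold>- (r \<^bold>; s) \<^bold>\<le> \<^bold>- s"
    using assms by (simp add: rle_iff tarski)
  ultimately show ?thesis
    using le_trans[of "r\<^sup>\<smile> \<^bold>; t"] assms by simp
qed

text \<open>Converse is monotone and its own inverse, so it fixes the unit; hence the converses of
  \<open>r\<close> and of its complement join to the unit. The opposite inclusion in
  \<open>conv_neg\<close> is this one applied to the converse of \<open>r\<close>.\<close>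

lemma conv_neg_le:
  assumes "r \<in> carrier A" shows "\<^bold>- (r\<^sup>\<smile>) \<^bold>\<le> (\<^bold>- r)\<^sup>\<smile>"
proof -
  have "r\<^sup>\<smile> \<^bold>+ (\<^bold>- r)\<^sup>\<smile> = \<^bold>1\<^sup>\<smile>"
    using assms by (metis conv_add add_neg neg_closed)
  also have "\<^bold>1\<^sup>\<smile> = \<^bold>1"
  proof (rule le_antisym)
    show "\<^bold>1\<^sup>\<smile> \<^bold>\<le> \<^bold>1" by (simp add: le_iff_meet meet_unit)
    then show "\<^bold>1 \<^bold>\<le> \<^bold>1\<^sup>\<smile>" by (simp add: conv_le_iff)
  qed auto
  finally have "\<^bold>- (r\<^sup>\<smile>) \<^bold>\<cdot> (r\<^sup>\<smile> \<^bold>+ (\<^bold>- r)\<^sup>\<smile>) = \<^bold>- (r\<^sup>\<smile>)"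
    using assms by (simp add: meet_unit)
  moreover have "\<^bold>- (r\<^sup>\<smile>) \<^bold>\<cdot> (r\<^sup>\<smile> \<^bold>+ (\<^bold>- r)\<^sup>\<smile>) = \<^bold>- (r\<^sup>\<smile>) \<^bold>\<cdot> (\<^bold>- r)\<^sup>\<smile>"
    using assms
    by (simp add: meet_add_distrib meet_commute[of "\<^bold>- (r\<^sup>\<smile>)" "r\<^sup>\<smile>"] meet_neg
        add_commute[of "\<^bold>0"] add_zero)
  ultimately show ?thesis
    using assms by (simp add: le_iff_meet)
qed

lemma conv_neg:
  assumes "r \<in> carrier A" shows "(\<^bold>- r)\<^sup>\<smile> = \<^bold>- (r\<^sup>\<smile>)"
proof (rule le_antisym)
  have "\<^bold>- ((r\<^sup>\<smile>)\<^sup>\<smile>) \<^bold>\<le> (\<^bold>- (r\<^sup>\<smile>))\<^sup>\<smile>"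
    using assms by (intro conv_neg_le) auto
  then show "(\<^bold>- r)\<^sup>\<smile> \<^bold>\<le> \<^bold>- (r\<^sup>\<smile>)"
    using assms by (simp add: conv_conv conv_le_iff)
qed (use assms conv_neg_le in auto)

text \<open>The first cycle law applied to converses, since converse reverses products.\<close>

lemma cycle2:
  assumes "r \<^bold>; s \<^bold>\<le> \<^bold>- t" "r \<in> carrier A" "s \<in> carrier A" "t \<in> carrier A"
  shows "t \<^bold>; s\<^sup>\<smile> \<^bold>\<le> \<^bold>- r"
proof -
  have "(r \<^bold>; s)\<^sup>\<smile> \<^bold>\<le> (\<^bold>- t)\<^sup>\<smile>"
    using assms by (intro conv_mono) auto
  then have "(s\<^sup>\<smile>)\<^sup>\<smile> \<^bold>; t\<^sup>\<smile> \<^bold>\<le> \<^bold>- (r\<^sup>\<smile>)"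
    using assms cycle1[of "s\<^sup>\<smile>" "r\<^sup>\<smile>" "t\<^sup>\<smile>"] by (simp add: conv_comp conv_neg)
  then have "((s\<^sup>\<smile>)\<^sup>\<smile> \<^bold>; t\<^sup>\<smile>)\<^sup>\<smile> \<^bold>\<le> (\<^bold>- (r\<^sup>\<smile>))\<^sup>\<smile>"
    using assms by (intro conv_mono) auto
  then show ?thesis
    using assms by (simp add: conv_comp conv_conv conv_neg)
qed

section \<open>Atoms\<close>

lemma atom_closed: "ra_atom A a \<Longrightarrow> a \<in> carrier A"
  by (simp add: ra_atom_def)

lemma atom_le_neg_iff:
  assumes "ra_atom A a" "c \<in> carrier A"
  shows "a \<^bold>\<le> \<^bold>- c \<longleftrightarrow> \<not> a \<^bold>\<le> c"
proof
  assume "a \<^bold>\<le> \<^bold>- c"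
  then have "a \<^bold>\<cdot> c = \<^bold>0"
    using assms by (simp add: meet_eq_zero_iff ra_atom_def)
  then show "\<not> a \<^bold>\<le> c"
    using assms by (metis le_iff_meet ra_atom_def)
next
  assume "\<not> a \<^bold>\<le> c"
  then have "a \<^bold>\<cdot> c \<noteq> a"
    using assms by (simp add: le_iff_meet ra_atom_def)
  then have "a \<^bold>\<cdot> c = \<^bold>0"
    using assms meet_le1[of a c] unfolding ra_atom_def by (meson meet_closed)
  then show "a \<^bold>\<le> \<^bold>- c"
    using assms by (simp add: meet_eq_zero_iff ra_atom_def)
qed

lemma atom_le_add_iff:
  assumes "ra_atom A a" "c \<in> carrier A" "d \<in> carrier A"
  shows "a \<^bold>\<le> c \<^bold>+ d \<longleftrightarrow> a \<^bold>\<le> c \<or> a \<^bold>\<le> d"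
proof
  assume ad: "a \<^bold>\<le> c \<^bold>+ d"
  have a: "a \<in> carrier A" using assms(1) by (rule atom_closed)
  show "a \<^bold>\<le> c \<or> a \<^bold>\<le> d"
  proof (rule ccontr)
    assume "\<not> (a \<^bold>\<le> c \<or> a \<^bold>\<le> d)"
    then have "a \<^bold>\<cdot> c = \<^bold>0" "a \<^bold>\<cdot> d = \<^bold>0"
      using assms a by (auto simp: meet_eq_zero_iff atom_le_neg_iff)
    then have "a \<^bold>\<cdot> (c \<^bold>+ d) = \<^bold>0"
      using assms a by (simp add: meet_add_distrib add_idem)
    then show False
      using ad assms a by (metis le_iff_meet ra_atom_def add_closed)
  qed
next
  assume "a \<^bold>\<le> c \<or> a \<^bold>\<le> d"
  then show "a \<^bold>\<le> c \<^bold>+ d"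
    using assms atom_closed[OF assms(1)] le_trans[of a c "c \<^bold>+ d"] le_trans[of a d "c \<^bold>+ d"]
    by (auto simp: le_add1 le_add2)
qed

lemma atom_conv:
  assumes "ra_atom A a" shows "ra_atom A (a\<^sup>\<smile>)"
  unfolding ra_atom_def
proof (intro conjI ballI impI)
  have a: "a \<in> carrier A" using assms by (rule atom_closed)
  have z: "\<^bold>0\<^sup>\<smile> = \<^bold>0"
    by (rule le_antisym) (simp_all add: zero_le conv_le_iff)
  show "a\<^sup>\<smile> \<in> carrier A" using a by simp
  show "a\<^sup>\<smile> \<noteq> \<^bold>0" using assms z a by (metis conv_conv ra_atom_def)
  fix b assume b: "b \<in> carrier A" "b \<^bold>\<le> a\<^sup>\<smile>"
  then have "b\<^sup>\<smile> = \<^bold>0 \<or> b\<^sup>\<smile> = a"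
    using assms a by (simp add: ra_atom_def flip: conv_le_iff)
  then show "b = \<^bold>0 \<or> b = a\<^sup>\<smile>"
    using b(1) z by (metis conv_conv)
qed

end


definition atomic :: "('a, 'm) rel_alg_scheme \<Rightarrow> bool"
  where "atomic A \<longleftrightarrow> (\<forall>c\<in>carrier A. c \<noteq> \<^bold>0\<^bsub>A\<^esub> \<longrightarrow> (\<exists>a. ra_atom A a \<and> a \<^bold>\<le>\<^bsub>A\<^esub> c))"

text \<open>The complex algebra of the atom structure. For an atomic algebra it is the concrete
  model of the completion, once it is known to be a relation algebra.\<close>

definition atom_alg :: "('a, 'm) rel_alg_scheme \<Rightarrow> 'a set rel_alg"
  where "atom_alg A =
    \<lparr>carrier = Pow {a. ra_atom A a}, radd = (\<union>), rneg = (\<lambda>X. {a. ra_atom A a} - X),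
     rcomp = (\<lambda>X Y. {t. ra_atom A t \<and> (\<exists>a\<in>X. \<exists>b\<in>Y. t \<^bold>\<le>\<^bsub>A\<^esub> a \<^bold>;\<^bsub>A\<^esub> b)}),
     rconv = (\<lambda>X. (\<lambda>a. a\<^sup>\<smile>\<^bsub>A\<^esub>) ` X), rid = {a. ra_atom A a \<and> a \<^bold>\<le>\<^bsub>A\<^esub> \<^bold>1'\<^bsub>A\<^esub>}\<rparr>"

text \<open>The cycle laws do the work of complete distributivity. If \<open>t\<close> is below
  \<open>c;d\<close>, then \<open>c\<close> meets the product of \<open>t\<close> with the converse
  of \<open>d\<close>; an atom \<open>a\<close> is chosen in this meet, and then an atom
  \<open>b\<close> in the meet of \<open>d\<close> with the product of the converse of
  \<open>a\<close> and \<open>t\<close>. Cycling back gives \<open>t\<close> below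
  \<open>a;b\<close>.\<close>

lemma (in relation_algebra) atom_le_comp_iff:
  assumes at: "atomic A" and t: "ra_atom A t" and c: "c \<in> carrier A" and d: "d \<in> carrier A"
  shows "t \<^bold>\<le> c \<^bold>; d \<longleftrightarrow> (\<exists>a b. ra_atom A a \<and> ra_atom A b \<and> a \<^bold>\<le> c \<and> b \<^bold>\<le> d \<and> t \<^bold>\<le> a \<^bold>; b)"
proof
  have tc: "t \<in> carrier A" using t by (rule atom_closed)
  assume "t \<^bold>\<le> c \<^bold>; d"
  then have "\<not> c \<^bold>; d \<^bold>\<le> \<^bold>- t"
    using neg_anti[of "c \<^bold>; d" "\<^bold>- t"] t tc c d atom_le_neg_iff[OF t] by (auto simp: neg_neg)
  then have "\<not> t \<^bold>; d\<^sup>\<smile> \<^bold>\<le> \<^bold>- c"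
    using cycle2[of t "d\<^sup>\<smile>" c] tc c d by (auto simp: conv_conv)
  then have "(t \<^bold>; d\<^sup>\<smile>) \<^bold>\<cdot> c \<noteq> \<^bold>0"
    using tc c d by (simp add: meet_eq_zero_iff)
  then obtain a where a: "ra_atom A a" "a \<^bold>\<le> (t \<^bold>; d\<^sup>\<smile>) \<^bold>\<cdot> c"
    using at tc c d unfolding atomic_def by (meson comp_closed conv_closed meet_closed)
  have ac: "a \<in> carrier A" using a(1) by (rule atom_closed)
  have a1: "a \<^bold>\<le> t \<^bold>; d\<^sup>\<smile>" "a \<^bold>\<le> c"
    using a tc c d ac le_trans[OF a(2) meet_le1] le_trans[OF a(2) meet_le2] by auto
  have "\<not> t \<^bold>; d\<^sup>\<smile> \<^bold>\<le> \<^bold>- a"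
    using a1(1) le_trans[of a "t \<^bold>; d\<^sup>\<smile>" "\<^bold>- a"] ac tc d atom_le_neg_iff[OF a(1) ac] le_refl[OF ac]
    by auto
  then have "\<not> a \<^bold>; d \<^bold>\<le> \<^bold>- t"
    using cycle2[of a d t] tc ac d by auto
  then have "\<not> a\<^sup>\<smile> \<^bold>; t \<^bold>\<le> \<^bold>- d"
    using cycle1[of "a\<^sup>\<smile>" t d] tc ac d by (auto simp: conv_conv)
  then have "(a\<^sup>\<smile> \<^bold>; t) \<^bold>\<cdot> d \<noteq> \<^bold>0"
    using tc ac d by (simp add: meet_eq_zero_iff)
  then obtain b where b: "ra_atom A b" "b \<^bold>\<le> (a\<^sup>\<smile> \<^bold>; t) \<^bold>\<cdot> d"
    using at tc ac d unfolding atomic_def by (meson comp_closed conv_closed meet_closed)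
  have bc: "b \<in> carrier A" using b(1) by (rule atom_closed)
  have b1: "b \<^bold>\<le> a\<^sup>\<smile> \<^bold>; t" "b \<^bold>\<le> d"
    using b tc ac d bc le_trans[OF b(2) meet_le1] le_trans[OF b(2) meet_le2] by auto
  have "\<not> a\<^sup>\<smile> \<^bold>; t \<^bold>\<le> \<^bold>- b"
    using b1(1) le_trans[of b "a\<^sup>\<smile> \<^bold>; t" "\<^bold>- b"] ac tc bc atom_le_neg_iff[OF b(1) bc] le_refl[OF bc]
    by auto
  then have "\<not> a \<^bold>; b \<^bold>\<le> \<^bold>- t"
    using cycle1[of a b t] tc ac bc by auto
  then have "t \<^bold>\<le> a \<^bold>; b"
    using neg_anti[of t "\<^bold>- (a \<^bold>; b)"] atom_le_neg_iff[OF t, of "a \<^bold>; b"] ac bc tc by (auto simp: neg_neg)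
  then show "\<exists>a b. ra_atom A a \<and> ra_atom A b \<and> a \<^bold>\<le> c \<and> b \<^bold>\<le> d \<and> t \<^bold>\<le> a \<^bold>; b"
    using a b a1 b1 by blast
next
  assume "\<exists>a b. ra_atom A a \<and> ra_atom A b \<and> a \<^bold>\<le> c \<and> b \<^bold>\<le> d \<and> t \<^bold>\<le> a \<^bold>; b"
  then show "t \<^bold>\<le> c \<^bold>; d"
    using c d atom_closed t by (meson comp_mono le_trans comp_closed)
qed


section \<open>Completions of atomic relation algebras\<close>

lemma ra_embedding_le_iff:
  assumes "relation_algebra A" "h \<in> ra_embedding A B" "a \<in> carrier A" "b \<in> carrier A"
  shows "h a \<^bold>\<le>\<^bsub>B\<^esub> h b \<longleftrightarrow> a \<^bold>\<le>\<^bsub>A\<^esub> b"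
proof -
  interpret relation_algebra A by fact
  have "h (a \<^bold>+\<^bsub>A\<^esub> b) = h a \<^bold>+\<^bsub>B\<^esub> h b" "inj_on h (carrier A)"
    using assms by (auto simp: ra_embedding_def ra_hom_def)
  then show ?thesis
    using assms(3,4) by (metis rle_iff inj_on_eq_iff add_closed)
qed

text \<open>Unit and zero are terms in the signature. Only closure of the source is assumed, so that
  the lemma applies to a structure not yet known to be a relation algebra.\<close>

lemma ra_hom_unit_zero:
  assumes "h \<in> ra_hom A B" "\<^bold>1'\<^bsub>A\<^esub> \<in> carrier A"
    "\<And>a b. \<lbrakk>a \<in> carrier A; b \<in> carrier A\<rbrakk> \<Longrightarrow> a \<^bold>+\<^bsub>A\<^esub> b \<in> carrier A"
    "\<And>a. a \<in> carrier A \<Longrightarrow> \<^bold>-\<^bsub>A\<^esub> a \<in> carrier A"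
  shows "h \<^bold>1\<^bsub>A\<^esub> = \<^bold>1\<^bsub>B\<^esub>" "h \<^bold>0\<^bsub>A\<^esub> = \<^bold>0\<^bsub>B\<^esub>"
proof -
  have *: "\<^bold>-\<^bsub>A\<^esub> \<^bold>1'\<^bsub>A\<^esub> \<in> carrier A" "\<^bold>1'\<^bsub>A\<^esub> \<^bold>+\<^bsub>A\<^esub> \<^bold>-\<^bsub>A\<^esub> \<^bold>1'\<^bsub>A\<^esub> \<in> carrier A"
    using assms(2-4) by auto
  show "h \<^bold>1\<^bsub>A\<^esub> = \<^bold>1\<^bsub>B\<^esub>"
    using assms(1,2) * by (simp add: ra_hom_def runit_def)
  with * show "h \<^bold>0\<^bsub>A\<^esub> = \<^bold>0\<^bsub>B\<^esub>"
    using assms(1) by (simp add: ra_hom_def rzero_def runit_def)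
qed

text \<open>Density makes the images of the atoms of \<open>B\<close> exactly the atoms of
  \<open>C\<close>. So \<open>C\<close> is atomic, its elements are determined by the atoms below
  them, and products are computed on atoms by \<open>atom_le_comp_iff\<close>. The lemma serves for
  \<open>C\<close> a completion, and also for \<open>C = B\<close> with \<open>e\<close> the
  identity.\<close>

lemma atom_set_embedding:
  assumes B: "relation_algebra B" and at: "atomic B" and C: "relation_algebra C"
    and e: "e \<in> ra_embedding B C"
    and dense: "\<forall>c\<in>carrier C. c \<noteq> \<^bold>0\<^bsub>C\<^esub> \<longrightarrow> (\<exists>b\<in>carrier B. e b \<noteq> \<^bold>0\<^bsub>C\<^esub> \<and> e b \<^bold>\<le>\<^bsub>C\<^esub> c)"
  shows "(\<lambda>c. {a. ra_atom B a \<and> e a \<^bold>\<le>\<^bsub>C\<^esub> c}) \<in> ra_embedding C (atom_alg B)" (is ?emb)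
    and "ra_atom B a \<Longrightarrow> ra_atom C (e a)"
proof -
  interpret B: relation_algebra B by fact
  interpret C: relation_algebra C by fact
  have e_hom: "e \<in> ra_hom B C" and inj: "inj_on e (carrier B)"
    using e by (auto simp: ra_embedding_def)
  have e_closed: "e b \<in> carrier C" if "b \<in> carrier B" for b
    using e_hom that by (auto simp: ra_hom_def)
  have e_zero: "e \<^bold>0\<^bsub>B\<^esub> = \<^bold>0\<^bsub>C\<^esub>"
    using e_hom by (intro ra_hom_unit_zero) auto
  have e_le: "e a \<^bold>\<le>\<^bsub>C\<^esub> e b \<longleftrightarrow> a \<^bold>\<le>\<^bsub>B\<^esub> b" if "a \<in> carrier B" "b \<in> carrier B" for a b
    using ra_embedding_le_iff[OF B e] that .
  have e_atom: "ra_atom C (e a)" if a: "ra_atom B a" for a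
    unfolding ra_atom_def
  proof (intro conjI ballI impI)
    have ac: "a \<in> carrier B" using a by (rule B.atom_closed)
    then show "e a \<in> carrier C" by (rule e_closed)
    show "e a \<noteq> \<^bold>0\<^bsub>C\<^esub>"
      using a ac inj e_zero by (metis B.zero_closed inj_on_eq_iff ra_atom_def)
    fix c assume c: "c \<in> carrier C" "c \<^bold>\<le>\<^bsub>C\<^esub> e a"
    show "c = \<^bold>0\<^bsub>C\<^esub> \<or> c = e a"
    proof (rule disjCI)
      assume "c \<noteq> e a"
      show "c = \<^bold>0\<^bsub>C\<^esub>"
      proof (rule ccontr)
        assume "c \<noteq> \<^bold>0\<^bsub>C\<^esub>"
        \<comment> \<open>By density a nonzero element below \<open>e a\<close> lies above some
          nonzero \<open>e b\<close>; then \<open>b\<close> is below the atom \<open>a\<close>, so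
          \<open>b = a\<close> and nothing lies strictly between.\<close>
        then obtain b where b: "b \<in> carrier B" "e b \<noteq> \<^bold>0\<^bsub>C\<^esub>" "e b \<^bold>\<le>\<^bsub>C\<^esub> c"
          using dense c by blast
        then have "e b \<^bold>\<le>\<^bsub>C\<^esub> e a"
          using c ac e_closed C.le_trans[of "e b" c "e a"] by auto
        then have "b = a"
          using a b ac e_zero by (auto simp: e_le ra_atom_def)
        then show False
          using b c ac e_closed \<open>c \<noteq> e a\<close> C.le_antisym[of c "e a"] by auto
      qed
    qed
  qed
  then show "ra_atom B a \<Longrightarrow> ra_atom C (e a)" .
  have e_dense: "\<exists>a. ra_atom B a \<and> e a \<^bold>\<le>\<^bsub>C\<^esub> c" if c: "c \<in> carrier C" "c \<noteq> \<^bold>0\<^bsub>C\<^esub>" for c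
  proof -
    obtain b where b: "b \<in> carrier B" "e b \<noteq> \<^bold>0\<^bsub>C\<^esub>" "e b \<^bold>\<le>\<^bsub>C\<^esub> c"
      using dense c by blast
    then obtain a where a: "ra_atom B a" "a \<^bold>\<le>\<^bsub>B\<^esub> b"
      using at e_zero unfolding atomic_def by metis
    then have "e a \<^bold>\<le>\<^bsub>C\<^esub> c"
      using b c B.atom_closed[OF a(1)] e_closed e_le[of a b] C.le_trans[of "e a" "e b" c] by auto
    with a show ?thesis by blast
  qed
  \<comment> \<open>An atom of \<open>C\<close> lies above the image of some atom of
    \<open>B\<close>; both being atoms, they coincide.\<close>
  have C_atom: "\<exists>a. ra_atom B a \<and> c = e a" if c: "ra_atom C c" for c
  proof -
    have "c \<noteq> \<^bold>0\<^bsub>C\<^esub>" using c by (simp add: ra_atom_def)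
    then obtain a where a: "ra_atom B a" "e a \<^bold>\<le>\<^bsub>C\<^esub> c"
      using e_dense C.atom_closed[OF c] by blast
    then show ?thesis
      using c e_atom[OF a(1)] by (auto simp: ra_atom_def)
  qed
  have C_atomic: "atomic C"
    unfolding atomic_def using e_dense e_atom by blast
  define h where "h = (\<lambda>c. {a. ra_atom B a \<and> e a \<^bold>\<le>\<^bsub>C\<^esub> c})"
  have "h \<in> ra_hom C (atom_alg B)"
    unfolding ra_hom_def mem_Collect_eq
  proof (intro conjI ballI)
    show "h \<in> carrier C \<rightarrow> carrier (atom_alg B)"
      by (auto simp: h_def atom_alg_def)
    show "h (c \<^bold>+\<^bsub>C\<^esub> d) = h c \<^bold>+\<^bsub>atom_alg B\<^esub> h d" if "c \<in> carrier C" "d \<in> carrier C" for c d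
      using that by (auto simp: h_def atom_alg_def C.atom_le_add_iff e_atom)
    show "h (\<^bold>-\<^bsub>C\<^esub> c) = \<^bold>-\<^bsub>atom_alg B\<^esub> h c" if "c \<in> carrier C" for c
      using that by (auto simp: h_def atom_alg_def C.atom_le_neg_iff e_atom)
    show "h (c\<^sup>\<smile>\<^bsub>C\<^esub>) = (h c)\<^sup>\<smile>\<^bsub>atom_alg B\<^esub>" if c: "c \<in> carrier C" for c
    proof -
      have conv: "e (a\<^sup>\<smile>\<^bsub>B\<^esub>) \<^bold>\<le>\<^bsub>C\<^esub> c \<longleftrightarrow> e a \<^bold>\<le>\<^bsub>C\<^esub> c\<^sup>\<smile>\<^bsub>C\<^esub>" if "a \<in> carrier B" for a
        using that c e_hom e_closed by (auto simp: ra_hom_def C.conv_le_iff)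
      have "a \<in> h (c\<^sup>\<smile>\<^bsub>C\<^esub>) \<longleftrightarrow> a \<in> (h c)\<^sup>\<smile>\<^bsub>atom_alg B\<^esub>" for a
      proof
        assume "a \<in> h (c\<^sup>\<smile>\<^bsub>C\<^esub>)"
        then have "a\<^sup>\<smile>\<^bsub>B\<^esub> \<in> h c" "a \<in> carrier B"
          using conv by (auto simp: h_def B.atom_conv B.atom_closed)
        then show "a \<in> (h c)\<^sup>\<smile>\<^bsub>atom_alg B\<^esub>"
          by (auto simp: atom_alg_def image_iff intro!: bexI[of _ "a\<^sup>\<smile>\<^bsub>B\<^esub>"] B.conv_conv[symmetric])
      next
        assume "a \<in> (h c)\<^sup>\<smile>\<^bsub>atom_alg B\<^esub>"
        then obtain b where b: "ra_atom B b" "e b \<^bold>\<le>\<^bsub>C\<^esub> c" "a = b\<^sup>\<smile>\<^bsub>B\<^esub>"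
          by (auto simp: h_def atom_alg_def)
        then show "a \<in> h (c\<^sup>\<smile>\<^bsub>C\<^esub>)"
          using conv[of a] B.atom_closed[of b] by (auto simp: h_def B.atom_conv B.conv_conv)
      qed
      then show ?thesis by blast
    qed
    show "h (c \<^bold>;\<^bsub>C\<^esub> d) = h c \<^bold>;\<^bsub>atom_alg B\<^esub> h d" if cd: "c \<in> carrier C" "d \<in> carrier C" for c d
    proof -
      have "e t \<^bold>\<le>\<^bsub>C\<^esub> c \<^bold>;\<^bsub>C\<^esub> d \<longleftrightarrow> (\<exists>a\<in>h c. \<exists>b\<in>h d. t \<^bold>\<le>\<^bsub>B\<^esub> a \<^bold>;\<^bsub>B\<^esub> b)"
        if t: "ra_atom B t" for t
      proof -
        have "e t \<^bold>\<le>\<^bsub>C\<^esub> c \<^bold>;\<^bsub>C\<^esub> d \<longleftrightarrow>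
          (\<exists>a b. ra_atom C a \<and> ra_atom C b \<and> a \<^bold>\<le>\<^bsub>C\<^esub> c \<and> b \<^bold>\<le>\<^bsub>C\<^esub> d \<and> e t \<^bold>\<le>\<^bsub>C\<^esub> a \<^bold>;\<^bsub>C\<^esub> b)"
          by (rule C.atom_le_comp_iff[OF C_atomic e_atom[OF t] cd])
        \<comment> \<open>\<open>C_atom\<close> moves the quantifiers from atoms of \<open>C\<close>
          to atoms of \<open>B\<close>.\<close>
        also have "\<dots> \<longleftrightarrow> (\<exists>a\<in>h c. \<exists>b\<in>h d. e t \<^bold>\<le>\<^bsub>C\<^esub> e a \<^bold>;\<^bsub>C\<^esub> e b)"
          unfolding h_def using C_atom e_atom by blast
        also have "\<dots> \<longleftrightarrow> (\<exists>a\<in>h c. \<exists>b\<in>h d. e t \<^bold>\<le>\<^bsub>C\<^esub> e (a \<^bold>;\<^bsub>B\<^esub> b))"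
          using e_hom by (intro bex_cong refl) (auto simp: h_def ra_hom_def B.atom_closed)
        also have "\<dots> \<longleftrightarrow> (\<exists>a\<in>h c. \<exists>b\<in>h d. t \<^bold>\<le>\<^bsub>B\<^esub> a \<^bold>;\<^bsub>B\<^esub> b)"
          using t by (intro bex_cong refl e_le) (auto simp: h_def B.atom_closed)
        finally show ?thesis .
      qed
      then have "t \<in> h (c \<^bold>;\<^bsub>C\<^esub> d) \<longleftrightarrow> t \<in> h c \<^bold>;\<^bsub>atom_alg B\<^esub> h d" for t
        by (auto simp: atom_alg_def h_def)
      then show ?thesis by blast
    qed
    have "e \<^bold>1'\<^bsub>B\<^esub> = \<^bold>1'\<^bsub>C\<^esub>" using e_hom by (simp add: ra_hom_def)
    then show "h \<^bold>1'\<^bsub>C\<^esub> = \<^bold>1'\<^bsub>atom_alg B\<^esub>"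
      using e_le[of _ "\<^bold>1'\<^bsub>B\<^esub>"] B.atom_closed by (auto simp: h_def atom_alg_def)
  qed
  moreover have "inj_on h (carrier C)"
  proof
    have le: "c \<^bold>\<le>\<^bsub>C\<^esub> d" if cd: "c \<in> carrier C" "d \<in> carrier C" "h c = h d" for c d
    proof (rule ccontr)
      assume "\<not> c \<^bold>\<le>\<^bsub>C\<^esub> d"
      \<comment> \<open>The part of \<open>c\<close> outside \<open>d\<close> is nonzero, and an
        atom in it belongs to \<open>h c\<close> but not to \<open>h d\<close>.\<close>
      then have "c \<^bold>\<cdot>\<^bsub>C\<^esub> \<^bold>-\<^bsub>C\<^esub> d \<noteq> \<^bold>0\<^bsub>C\<^esub>" using cd by (simp add: C.le_iff_meet_neg)
      then obtain a where a: "ra_atom B a" "e a \<^bold>\<le>\<^bsub>C\<^esub> c \<^bold>\<cdot>\<^bsub>C\<^esub> \<^bold>-\<^bsub>C\<^esub> d"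
        using e_dense cd by (meson C.meet_closed C.neg_closed)
      then have "e a \<^bold>\<le>\<^bsub>C\<^esub> c" "e a \<^bold>\<le>\<^bsub>C\<^esub> \<^bold>-\<^bsub>C\<^esub> d"
        using cd C.atom_closed[OF e_atom[OF a(1)]] C.le_trans[OF a(2) C.meet_le1]
          C.le_trans[OF a(2) C.meet_le2] by auto
      then show False
        using a cd C.atom_le_neg_iff[OF e_atom[OF a(1)]] by (auto simp: h_def)
    qed
    show "c = d" if "c \<in> carrier C" "d \<in> carrier C" "h c = h d" for c d
      using that by (intro C.le_antisym le) auto
  qed
  ultimately show ?emb
    by (simp add: h_def ra_embedding_def)
qed

text \<open>Only surjectivity has to be added to \<open>atom_set_embedding\<close>: a set
  \<open>X\<close> of atoms is the value at the supremum of its images, which completeness of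
  \<open>C\<close> provides.\<close>

lemma completion_isomorphic_atom_alg:
  assumes B: "relation_algebra B" and at: "atomic B" and C: "is_completion B C"
  shows "ra_isomorphic C (atom_alg B)"
proof -
  obtain e where e: "e \<in> ra_embedding B C"
    and dense: "\<forall>c\<in>carrier C. c \<noteq> \<^bold>0\<^bsub>C\<^esub> \<longrightarrow> (\<exists>b\<in>carrier B. e b \<noteq> \<^bold>0\<^bsub>C\<^esub> \<and> e b \<^bold>\<le>\<^bsub>C\<^esub> c)"
    and RC: "relation_algebra C" and CC: "complete_lattice (ra_order C)"
    using C by (auto simp: is_completion_def complete_rel_alg_def)
  interpret B: relation_algebra B by fact
  interpret C: relation_algebra C by fact
  define h where "h = (\<lambda>c. {a. ra_atom B a \<and> e a \<^bold>\<le>\<^bsub>C\<^esub> c})"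
  have h: "h \<in> ra_embedding C (atom_alg B)"
    unfolding h_def by (rule atom_set_embedding(1)[OF B at RC e dense])
  have e_atom: "ra_atom C (e a)" if "ra_atom B a" for a
    using atom_set_embedding(2)[OF B at RC e dense that] .
  have "Pow {a. ra_atom B a} \<subseteq> h ` carrier C"
  proof
    fix X assume X: "X \<in> Pow {a. ra_atom B a}"
    have eX: "e ` X \<subseteq> carrier C"
      using X e_atom C.atom_closed by auto
    then obtain c where "is_sum C c (e ` X)"
      using complete_lattice.sup_exists[OF CC, of "e ` X"] by auto
    then have c: "c \<in> carrier C" and ub: "\<And>a. a \<in> X \<Longrightarrow> e a \<^bold>\<le>\<^bsub>C\<^esub> c"
      and lub: "\<And>d. \<lbrakk>d \<in> carrier C; \<forall>a\<in>X. e a \<^bold>\<le>\<^bsub>C\<^esub> d\<rbrakk> \<Longrightarrow> c \<^bold>\<le>\<^bsub>C\<^esub> d"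
      using eX by (auto simp: is_sum_iff)
    have "t \<in> X" if t: "ra_atom B t" "e t \<^bold>\<le>\<^bsub>C\<^esub> c" for t
    proof (rule ccontr)
      assume "t \<notin> X"
      have et: "e t \<in> carrier C" using e_atom[OF t(1)] by (rule C.atom_closed)
      \<comment> \<open>An atom \<open>t\<close> outside \<open>X\<close> is disjoint from every
        member of \<open>X\<close>, so the complement of its image is an upper bound and lies above
        the supremum.\<close>
      have "c \<^bold>\<le>\<^bsub>C\<^esub> \<^bold>-\<^bsub>C\<^esub> e t"
      proof (rule lub)
        show "\<forall>a\<in>X. e a \<^bold>\<le>\<^bsub>C\<^esub> \<^bold>-\<^bsub>C\<^esub> e t"
        proof
          fix a assume a: "a \<in> X"
          then have aa: "ra_atom B a" using X by auto
          have "\<not> e a \<^bold>\<le>\<^bsub>C\<^esub> e t"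
          proof
            assume "e a \<^bold>\<le>\<^bsub>C\<^esub> e t"
            then have "a \<^bold>\<le>\<^bsub>B\<^esub> t"
              using B.atom_closed[OF aa] B.atom_closed[OF t(1)] ra_embedding_le_iff[OF B e] by simp
            then have "a = t" using aa t(1) unfolding ra_atom_def by blast
            with a \<open>t \<notin> X\<close> show False by simp
          qed
          then show "e a \<^bold>\<le>\<^bsub>C\<^esub> \<^bold>-\<^bsub>C\<^esub> e t"
            using et by (simp add: C.atom_le_neg_iff[OF e_atom[OF aa]])
        qed
      qed (use et in auto)
      then have "e t \<^bold>\<le>\<^bsub>C\<^esub> \<^bold>-\<^bsub>C\<^esub> e t"
        using t et c C.le_trans[of "e t" c] by auto
      then show False
        using et C.le_refl[OF et] by (simp add: C.atom_le_neg_iff[OF e_atom[OF t(1)]])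
    qed
    then have "h c = X"
      using X ub by (auto simp: h_def)
    with c show "X \<in> h ` carrier C" by blast
  qed
  then have "bij_betw h (carrier C) (carrier (atom_alg B))"
    using h by (auto simp: ra_embedding_def ra_hom_def bij_betw_def atom_alg_def)
  then show ?thesis
    using h by (auto simp: ra_isomorphic_def ra_embedding_def)
qed

text \<open>Completeness is that of a powerset; the embedding is \<open>atom_set_embedding\<close>
  for the identity on \<open>B\<close>, and density holds because an atom goes to the singleton of
  itself. That the complex algebra satisfies the axioms is assumed here; a representation supplies
  it later.\<close>

lemma atom_alg_is_completion:
  assumes B: "relation_algebra B" and at: "atomic B" and RA: "relation_algebra (atom_alg B)"
  shows "is_completion B (atom_alg B)"
proof -
  interpret B: relation_algebra B by fact
  have "id \<in> ra_embedding B B"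
    by (auto simp: ra_embedding_def ra_hom_def)
  moreover have "\<forall>c\<in>carrier B. c \<noteq> \<^bold>0\<^bsub>B\<^esub> \<longrightarrow> (\<exists>b\<in>carrier B. id b \<noteq> \<^bold>0\<^bsub>B\<^esub> \<and> id b \<^bold>\<le>\<^bsub>B\<^esub> c)"
    using B.le_refl by auto
  ultimately have emb: "(\<lambda>c. {a. ra_atom B a \<and> id a \<^bold>\<le>\<^bsub>B\<^esub> c}) \<in> ra_embedding B (atom_alg B)"
    by (intro atom_set_embedding B at)
  have sub: "X \<^bold>\<le>\<^bsub>atom_alg B\<^esub> Y \<longleftrightarrow> X \<subseteq> Y" for X Y
    by (auto simp: rle_iff atom_alg_def)
  have car: "carrier (atom_alg B) = Pow {a. ra_atom B a}"
    by (simp add: atom_alg_def)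
  have zero: "\<^bold>0\<^bsub>atom_alg B\<^esub> = {}"
    by (auto simp: rzero_def runit_def atom_alg_def)
  have eq: "(.=\<^bsub>ra_order (atom_alg B)\<^esub>) = (=)"
    by (simp add: ra_order_def)
  have po: "partial_order (ra_order (atom_alg B))"
    by unfold_locales (auto simp: sub eq)
  have "complete_lattice (ra_order (atom_alg B))"
  proof (rule partial_order.complete_latticeI[OF po])
    fix X assume X: "X \<subseteq> carrier (ra_order (atom_alg B))"
    then show "\<exists>s. is_lub (ra_order (atom_alg B)) s X"
      by (intro exI[of _ "\<Union>X"]) (auto simp: is_sum_iff sub, auto simp: atom_alg_def)
    \<comment> \<open>Intersecting with the set of all atoms gives the right value for empty
      \<open>X\<close>, whose intersection is the whole type.\<close>
    let ?i = "{a. ra_atom B a} \<inter> \<Inter>X"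
    show "\<exists>i. is_glb (ra_order (atom_alg B)) i X"
      by (intro exI[of _ ?i]) (use X in \<open>auto simp: greatest_def Lower_def sub car; blast\<close>)
  qed
  moreover have "\<exists>b\<in>carrier B. {a. ra_atom B a \<and> id a \<^bold>\<le>\<^bsub>B\<^esub> b} \<noteq> \<^bold>0\<^bsub>atom_alg B\<^esub>
      \<and> {a. ra_atom B a \<and> id a \<^bold>\<le>\<^bsub>B\<^esub> b} \<^bold>\<le>\<^bsub>atom_alg B\<^esub> X"
    if X: "X \<in> carrier (atom_alg B)" "X \<noteq> \<^bold>0\<^bsub>atom_alg B\<^esub>" for X
  proof -
    obtain t where t: "t \<in> X" "ra_atom B t"
      using X unfolding zero car by blast
    have "{a. ra_atom B a \<and> id a \<^bold>\<le>\<^bsub>B\<^esub> t} = {t}"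
      using t(2) B.le_refl[of t] by (auto simp: ra_atom_def)
    then show ?thesis
      using t B.atom_closed[OF t(2)] unfolding zero sub by (intro bexI[of _ t]) auto
  qed
  ultimately show ?thesis
    unfolding is_completion_def complete_rel_alg_def
    by (intro conjI RA bexI[OF _ emb] ballI impI)
qed

section \<open>Set relation algebras and reflection of the axioms\<close>

lemma full_set_rel_alg_unit_zero:
  assumes "equiv U E"
  shows "\<^bold>1\<^bsub>full_set_rel_alg U E\<^esub> = E" "\<^bold>0\<^bsub>full_set_rel_alg U E\<^esub> = {}"
proof -
  show "\<^bold>1\<^bsub>full_set_rel_alg U E\<^esub> = E"
    using assms by (auto simp: runit_def full_set_rel_alg_def equiv_def refl_on_def)
  then show "\<^bold>0\<^bsub>full_set_rel_alg U E\<^esub> = {}"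
    by (simp add: rzero_def full_set_rel_alg_def)
qed

lemma relation_algebra_full_set_rel_alg:
  assumes "equiv U E"
  shows "relation_algebra (full_set_rel_alg U E)"
proof -
  have E: "E \<subseteq> U \<times> U" "sym E" "trans E" "refl_on U E"
    using assms by (auto simp: equiv_def refl_on_def)
  note unit = full_set_rel_alg_unit_zero(1)[OF assms] and zero = full_set_rel_alg_unit_zero(2)[OF assms]
  have meet: "R \<^bold>\<cdot>\<^bsub>full_set_rel_alg U E\<^esub> S = E \<inter> R \<inter> S" for R S
    by (auto simp: rmeet_def full_set_rel_alg_def)
  show ?thesis
  proof (unfold_locales, unfold unit zero meet)
    show "R \<^bold>;\<^bsub>full_set_rel_alg U E\<^esub> S \<in> carrier (full_set_rel_alg U E)"
      if "R \<in> carrier (full_set_rel_alg U E)" "S \<in> carrier (full_set_rel_alg U E)" for R S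
      using that \<open>trans E\<close> unfolding full_set_rel_alg_def by (auto dest: transD)
    show "R\<^sup>\<smile>\<^bsub>full_set_rel_alg U E\<^esub> \<in> carrier (full_set_rel_alg U E)"
      if "R \<in> carrier (full_set_rel_alg U E)" for R
      using that \<open>sym E\<close> unfolding full_set_rel_alg_def by (auto dest: symD)
    show "\<^bold>1'\<^bsub>full_set_rel_alg U E\<^esub> \<in> carrier (full_set_rel_alg U E)"
      using \<open>refl_on U E\<close> unfolding full_set_rel_alg_def by (auto simp: refl_on_def)
    show "R \<^bold>;\<^bsub>full_set_rel_alg U E\<^esub> \<^bold>1'\<^bsub>full_set_rel_alg U E\<^esub> = R"
      if "R \<in> carrier (full_set_rel_alg U E)" for R
      using that E(1) unfolding full_set_rel_alg_def by auto
    show "(R\<^sup>\<smile>\<^bsub>full_set_rel_alg U E\<^esub> \<^bold>;\<^bsub>full_set_rel_alg U E\<^esub>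
        \<^bold>-\<^bsub>full_set_rel_alg U E\<^esub> (R \<^bold>;\<^bsub>full_set_rel_alg U E\<^esub> S))
        \<^bold>+\<^bsub>full_set_rel_alg U E\<^esub> \<^bold>-\<^bsub>full_set_rel_alg U E\<^esub> S = \<^bold>-\<^bsub>full_set_rel_alg U E\<^esub> S"
      if "R \<in> carrier (full_set_rel_alg U E)" "S \<in> carrier (full_set_rel_alg U E)" for R S
      using that \<open>sym E\<close> \<open>trans E\<close> unfolding full_set_rel_alg_def by (auto dest: transD symD)
  qed (auto simp: full_set_rel_alg_def)
qed

text \<open>Apart from closure, all axioms are equations between terms, so an injective homomorphism
  reflects them from \<open>B\<close>.\<close>

lemma relation_algebra_of_embedding:
  assumes B: "relation_algebra B" and h: "h \<in> ra_embedding A B"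
    and "\<And>a b. \<lbrakk>a \<in> carrier A; b \<in> carrier A\<rbrakk> \<Longrightarrow> a \<^bold>+\<^bsub>A\<^esub> b \<in> carrier A"
    and "\<And>a. a \<in> carrier A \<Longrightarrow> \<^bold>-\<^bsub>A\<^esub> a \<in> carrier A"
    and "\<And>a b. \<lbrakk>a \<in> carrier A; b \<in> carrier A\<rbrakk> \<Longrightarrow> a \<^bold>;\<^bsub>A\<^esub> b \<in> carrier A"
    and "\<And>a. a \<in> carrier A \<Longrightarrow> a\<^sup>\<smile>\<^bsub>A\<^esub> \<in> carrier A"
    and "\<^bold>1'\<^bsub>A\<^esub> \<in> carrier A"
  shows "relation_algebra A"
proof -
  interpret B: relation_algebra B by fact
  note closed [simp] = assms(3-7)
  have hom: "h \<in> ra_hom A B" and inj: "inj_on h (carrier A)"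
    using h by (auto simp: ra_embedding_def)
  have [simp]: "\<^bold>1\<^bsub>A\<^esub> \<in> carrier A" "\<^bold>0\<^bsub>A\<^esub> \<in> carrier A"
    by (simp_all add: runit_def rzero_def)
  have [simp]: "a \<^bold>\<cdot>\<^bsub>A\<^esub> b \<in> carrier A" if "a \<in> carrier A" "b \<in> carrier A" for a b
    using that by (simp add: rmeet_def)
  have [simp]: "h a \<in> carrier B" if "a \<in> carrier A" for a
    using that hom by (auto simp: ra_hom_def)
  have [simp]: "h (a \<^bold>+\<^bsub>A\<^esub> b) = h a \<^bold>+\<^bsub>B\<^esub> h b" "h (\<^bold>-\<^bsub>A\<^esub> a) = \<^bold>-\<^bsub>B\<^esub> h a"
    "h (a \<^bold>;\<^bsub>A\<^esub> b) = h a \<^bold>;\<^bsub>B\<^esub> h b" "h (a\<^sup>\<smile>\<^bsub>A\<^esub>) = (h a)\<^sup>\<smile>\<^bsub>B\<^esub>"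
    if "a \<in> carrier A" "b \<in> carrier A" for a b
    using that hom by (auto simp: ra_hom_def)
  have [simp]: "h \<^bold>1'\<^bsub>A\<^esub> = \<^bold>1'\<^bsub>B\<^esub>" using hom by (simp add: ra_hom_def)
  have [simp]: "h (a \<^bold>\<cdot>\<^bsub>A\<^esub> b) = h a \<^bold>\<cdot>\<^bsub>B\<^esub> h b" if "a \<in> carrier A" "b \<in> carrier A" for a b
    using that by (simp add: rmeet_def)
  have [simp]: "h \<^bold>1\<^bsub>A\<^esub> = \<^bold>1\<^bsub>B\<^esub>" "h \<^bold>0\<^bsub>A\<^esub> = \<^bold>0\<^bsub>B\<^esub>"
    by (auto intro!: ra_hom_unit_zero hom)
  show ?thesis
    apply unfold_locales
                      apply (simp_all)
    subgoal by (rule inj_onD[OF inj]) (simp_all add: B.add_assoc)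
    subgoal by (rule inj_onD[OF inj]) (simp_all add: B.meet_assoc)
    subgoal by (rule inj_onD[OF inj]) (simp_all add: B.add_commute)
    subgoal by (rule inj_onD[OF inj]) (simp_all add: B.meet_commute)
    subgoal by (rule inj_onD[OF inj]) (simp_all add: B.meet_add_distrib)
    subgoal by (rule inj_onD[OF inj]) (simp_all add: B.add_meet_distrib)
    subgoal by (rule inj_onD[OF inj]) (simp_all add: B.meet_unit)
    subgoal by (rule inj_onD[OF inj]) (simp_all add: B.add_zero)
    subgoal by (rule inj_onD[OF inj]) (simp_all add: B.meet_neg)
    subgoal by (rule inj_onD[OF inj]) (simp_all add: B.add_neg)
    subgoal by (rule inj_onD[OF inj]) (simp_all add: B.comp_assoc)
    subgoal by (rule inj_onD[OF inj]) (simp_all add: B.comp_id)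
    subgoal by (rule inj_onD[OF inj]) (simp_all add: B.conv_conv)
    subgoal by (rule inj_onD[OF inj]) (simp_all add: B.conv_comp)
    subgoal by (rule inj_onD[OF inj]) (simp_all add: B.comp_add_distrib)
    subgoal by (rule inj_onD[OF inj]) (simp_all add: B.conv_add)
    subgoal by (rule inj_onD[OF inj]) (simp_all add: B.tarski)
    done
qed

lemma ra_isomorphic_trans:
  assumes "ra_isomorphic A B" "ra_isomorphic B C"
  shows "ra_isomorphic A C"
proof -
  obtain g h where g: "g \<in> ra_hom A B" "bij_betw g (carrier A) (carrier B)"
    and h: "h \<in> ra_hom B C" "bij_betw h (carrier B) (carrier C)"
    using assms by (auto simp: ra_isomorphic_def)
  then have "h \<circ> g \<in> ra_hom A C"
    by (auto simp: ra_hom_def Pi_iff)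
  with g h show ?thesis
    unfolding ra_isomorphic_def by (blast intro: bij_betw_trans)
qed


section \<open>Frames from subdirect subgroups\<close>

text \<open>Each \<open>S x y\<close> is a subgroup of the product of two groups that projects onto
  both factors: onto the first by \<open>S_total\<close>, onto the second by \<open>S_total\<close>
  for \<open>(y, x)\<close> together with \<open>S_conv\<close>. \<open>S_comp\<close> is only an
  inclusion: the composite can be larger, and the frame conditions compare the two only modulo
  normal subgroups.\<close>

locale subdirect_system =
  fixes I :: "'i set" and EE :: "'i rel" and G :: "'i \<Rightarrow> 'g monoid"
    and S :: "'i \<Rightarrow> 'i \<Rightarrow> 'g rel"
  assumes group_G: "x \<in> I \<Longrightarrow> group (G x)"
    and disjoint_G: "disjoint_family_on (\<lambda>x. carrier (G x)) I"
    and equiv_EE: "equiv I EE"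
    and S_carrier: "\<lbrakk>(x, y) \<in> EE; (f, g) \<in> S x y\<rbrakk> \<Longrightarrow> f \<in> carrier (G x) \<and> g \<in> carrier (G y)"
    and S_mult: "\<lbrakk>(x, y) \<in> EE; (f, g) \<in> S x y; (f', g') \<in> S x y\<rbrakk>
      \<Longrightarrow> (f \<otimes>\<^bsub>G x\<^esub> f', g \<otimes>\<^bsub>G y\<^esub> g') \<in> S x y"
    and S_inv: "\<lbrakk>(x, y) \<in> EE; (f, g) \<in> S x y\<rbrakk> \<Longrightarrow> (inv\<^bsub>G x\<^esub> f, inv\<^bsub>G y\<^esub> g) \<in> S x y"
    and S_total: "\<lbrakk>(x, y) \<in> EE; f \<in> carrier (G x)\<rbrakk> \<Longrightarrow> \<exists>g. (f, g) \<in> S x y"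
    and S_refl: "x \<in> I \<Longrightarrow> S x x = Id_on (carrier (G x))"
    and S_conv: "(x, y) \<in> EE \<Longrightarrow> S y x = (S x y)\<inverse>"
    and S_comp: "\<lbrakk>(x, y) \<in> EE; (y, z) \<in> EE\<rbrakk> \<Longrightarrow> S x z \<subseteq> S x y O S y z"
begin

text \<open>The left Goursat kernel of \<open>S x y\<close>; by \<open>S_conv\<close> the right one
  is \<open>kern y x\<close>.\<close>

definition kern :: "'i \<Rightarrow> 'i \<Rightarrow> 'g set"
  where "kern x y = {f. (f, \<one>\<^bsub>G y\<^esub>) \<in> S x y}"

text \<open>Goursat's isomorphism is the image map of \<open>S x y\<close> on cosets; a coset of
  \<open>kern x y\<close> goes to a coset of \<open>kern y x\<close>.\<close>

definition frame :: "('i, 'g) group_pair"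
  where "frame = \<lparr>idx = I, ieq = EE, grp = G, Hsub = kern, Ksub = (\<lambda>x y. kern y x),
    quot_iso = (\<lambda>x y \<xi>. S x y `` \<xi>)\<rparr>"

lemma frame_simps:
  "idx frame = I" "ieq frame = EE" "grp frame = G" "Hsub frame = kern"
  "Ksub frame x y = kern y x" "quot_iso frame x y \<xi> = S x y `` \<xi>"
  by (simp_all add: frame_def)

lemma EE_I: "(x, y) \<in> EE \<Longrightarrow> x \<in> I \<and> y \<in> I"
  using equiv_EE by (auto simp: equiv_def refl_on_def)

lemma EE_sym: "(x, y) \<in> EE \<Longrightarrow> (y, x) \<in> EE"
  using equiv_EE by (auto simp: equiv_def dest: symD)

lemma EE_trans: "\<lbrakk>(x, y) \<in> EE; (y, z) \<in> EE\<rbrakk> \<Longrightarrow> (x, z) \<in> EE"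
  using equiv_EE by (auto simp: equiv_def dest: transD)

lemma S_conv_iff: "(x, y) \<in> EE \<Longrightarrow> (g, f) \<in> S y x \<longleftrightarrow> (f, g) \<in> S x y"
  using S_conv by blast

text \<open>\<open>S_total\<close> gives some partner of the identity; the product of that pair with
  its inverse is the pair of identities.\<close>

lemma S_one: "(\<one>\<^bsub>G x\<^esub>, \<one>\<^bsub>G y\<^esub>) \<in> S x y" if xy: "(x, y) \<in> EE"
proof -
  interpret X: group "G x" using group_G EE_I[OF xy] by simp
  interpret Y: group "G y" using group_G EE_I[OF xy] by simp
  obtain g where g: "(\<one>\<^bsub>G x\<^esub>, g) \<in> S x y"
    using S_total[OF xy] by blast
  have "g \<in> carrier (G y)" using S_carrier[OF xy g] by simp
  then show ?thesis
    using S_mult[OF xy g S_inv[OF xy g]] by simp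
qed

lemma S_cancel:
  assumes xy: "(x, y) \<in> EE" and fg: "(f, g) \<in> S x y" and "(f \<otimes>\<^bsub>G x\<^esub> f', g \<otimes>\<^bsub>G y\<^esub> g') \<in> S x y"
    and f': "f' \<in> carrier (G x)" and g': "g' \<in> carrier (G y)"
  shows "(f', g') \<in> S x y"
proof -
  interpret X: group "G x" using group_G EE_I[OF xy] by simp
  interpret Y: group "G y" using group_G EE_I[OF xy] by simp
  show ?thesis
    using S_mult[OF xy S_inv[OF xy fg] assms(3)] S_carrier[OF xy fg] f' g'
    by (simp flip: X.m_assoc Y.m_assoc)
qed

text \<open>Conjugation by \<open>f\<close> lifts to conjugation by a pair \<open>(f, g)\<close> of
  \<open>S x y\<close>, which leaves the second component at the identity.\<close>

lemma kern_normal: "kern x y \<lhd> G x" if xy: "(x, y) \<in> EE"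
proof -
  interpret X: group "G x" using group_G EE_I[OF xy] by simp
  interpret Y: group "G y" using group_G EE_I[OF xy] by simp
  have "subgroup (kern x y) (G x)"
  proof
    show "kern x y \<subseteq> carrier (G x)" using S_carrier[OF xy] by (auto simp: kern_def)
    show "\<one>\<^bsub>G x\<^esub> \<in> kern x y" using S_one[OF xy] by (simp add: kern_def)
    show "f \<otimes>\<^bsub>G x\<^esub> f' \<in> kern x y" if "f \<in> kern x y" "f' \<in> kern x y" for f f'
      using S_mult[OF xy, of f _ f'] that by (fastforce simp: kern_def)
    show "inv\<^bsub>G x\<^esub> f \<in> kern x y" if "f \<in> kern x y" for f
      using S_inv[OF xy, of f] that by (fastforce simp: kern_def)
  qed
  moreover have "f \<otimes>\<^bsub>G x\<^esub> h \<otimes>\<^bsub>G x\<^esub> inv\<^bsub>G x\<^esub> f \<in> kern x y"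
    if f: "f \<in> carrier (G x)" and h: "h \<in> kern x y" for f h
  proof -
    obtain g where g: "(f, g) \<in> S x y" using S_total[OF xy f] by blast
    have h': "(h, \<one>\<^bsub>G y\<^esub>) \<in> S x y" using h by (simp add: kern_def)
    show ?thesis
      using S_mult[OF xy S_mult[OF xy g h'] S_inv[OF xy g]] S_carrier[OF xy g] by (simp add: kern_def)
  qed
  ultimately show ?thesis by (rule X.normal_invI)
qed

text \<open>Two partners of the same element differ by a factor in \<open>kern y x\<close>, and
  changing the first component by a factor in \<open>kern x y\<close> keeps the partner.\<close>

lemma S_image_coset:
  assumes xy: "(x, y) \<in> EE" and fg: "(f, g) \<in> S x y"
  shows "S x y `` (kern x y #>\<^bsub>G x\<^esub> f) = kern y x #>\<^bsub>G y\<^esub> g"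
proof -
  interpret X: group "G x" using group_G EE_I[OF xy] by simp
  interpret Y: group "G y" using group_G EE_I[OF xy] by simp
  have c: "f \<in> carrier (G x)" "g \<in> carrier (G y)" using S_carrier[OF xy fg] by auto
  show ?thesis
  proof (intro equalityI subsetI)
    fix k assume "k \<in> S x y `` (kern x y #>\<^bsub>G x\<^esub> f)"
    then obtain h where h: "(h, \<one>\<^bsub>G y\<^esub>) \<in> S x y" and k: "(h \<otimes>\<^bsub>G x\<^esub> f, k) \<in> S x y"
      by (auto simp: kern_def r_coset_def)
    have kc: "k \<in> carrier (G y)" using S_carrier[OF xy k] by simp
    have "(f, k) \<in> S x y"
      using S_cancel[OF xy h, of f k] k kc c by simp
    then have "(\<one>\<^bsub>G x\<^esub>, k \<otimes>\<^bsub>G y\<^esub> inv\<^bsub>G y\<^esub> g) \<in> S x y"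
      using S_mult[OF xy _ S_inv[OF xy fg], of f k] c by simp
    then have "k \<otimes>\<^bsub>G y\<^esub> inv\<^bsub>G y\<^esub> g \<in> kern y x"
      by (simp add: kern_def S_conv_iff[OF xy])
    moreover have "k = k \<otimes>\<^bsub>G y\<^esub> inv\<^bsub>G y\<^esub> g \<otimes>\<^bsub>G y\<^esub> g"
      using kc c by (simp add: Y.m_assoc)
    ultimately show "k \<in> kern y x #>\<^bsub>G y\<^esub> g"
      unfolding r_coset_def by blast
  next
    fix k assume "k \<in> kern y x #>\<^bsub>G y\<^esub> g"
    then obtain m where m: "(\<one>\<^bsub>G x\<^esub>, m) \<in> S x y" "k = m \<otimes>\<^bsub>G y\<^esub> g"
      by (auto simp: kern_def r_coset_def S_conv_iff[OF xy])
    then have "(\<one>\<^bsub>G x\<^esub> \<otimes>\<^bsub>G x\<^esub> f, k) \<in> S x y"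
      using S_mult[OF xy m(1) fg] by simp
    then show "k \<in> S x y `` (kern x y #>\<^bsub>G x\<^esub> f)"
      using S_one[OF xy] by (auto simp: kern_def r_coset_def)
  qed
qed

text \<open>\<open>S x y\<close> is invariant under factors from \<open>kern x y\<close>, so
  membership of a pair can be read off from the whole coset.\<close>

lemma mem_S_image_coset:
  assumes xy: "(x, y) \<in> EE" and f: "f \<in> carrier (G x)"
  shows "g \<in> S x y `` (kern x y #>\<^bsub>G x\<^esub> f) \<longleftrightarrow> (f, g) \<in> S x y"
proof
  interpret X: group "G x" using group_G EE_I[OF xy] by simp
  interpret Y: group "G y" using group_G EE_I[OF xy] by simp
  show "(f, g) \<in> S x y" if "g \<in> S x y `` (kern x y #>\<^bsub>G x\<^esub> f)"
  proof -
    from that obtain h where h: "(h, \<one>\<^bsub>G y\<^esub>) \<in> S x y" and k: "(h \<otimes>\<^bsub>G x\<^esub> f, g) \<in> S x y"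
      by (auto simp: kern_def r_coset_def)
    then show ?thesis
      using S_cancel[OF xy h, of f g] f S_carrier[OF xy k] by simp
  qed
  show "g \<in> S x y `` (kern x y #>\<^bsub>G x\<^esub> f)" if "(f, g) \<in> S x y"
  proof -
    have "f \<in> kern x y #>\<^bsub>G x\<^esub> f"
      using S_one[OF xy] f unfolding r_coset_def kern_def by force
    with that show ?thesis by blast
  qed
qed

text \<open>By \<open>S_image_coset\<close> the image maps of \<open>S x y\<close> and
  \<open>S y x\<close> undo each other on cosets; multiplicativity is checked on representatives by
  \<open>S_mult\<close>.\<close>

lemma S_image_iso:
  assumes xy: "(x, y) \<in> EE"
  shows "(\<lambda>\<xi>. S x y `` \<xi>) \<in> iso (G x Mod kern x y) (G y Mod kern y x)"
    and "\<xi> \<in> carrier (G y Mod kern y x) \<Longrightarrow> S y x `` \<xi> =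
      inv_into (carrier (G x Mod kern x y)) (\<lambda>\<xi>. S x y `` \<xi>) \<xi>"
proof -
  note yx = EE_sym[OF xy]
  interpret X: normal "kern x y" "G x" using kern_normal[OF xy] .
  interpret Y: normal "kern y x" "G y" using kern_normal[OF yx] .
  have closed: "S x y `` \<xi> \<in> carrier (G y Mod kern y x) \<and> S y x `` (S x y `` \<xi>) = \<xi>"
    if xy: "(x, y) \<in> EE" and "\<xi> \<in> carrier (G x Mod kern x y)" for x y \<xi>
  proof -
    from that obtain f where f: "f \<in> carrier (G x)" "\<xi> = kern x y #>\<^bsub>G x\<^esub> f"
      by (auto simp: FactGroup_def RCOSETS_def)
    obtain g where g: "(f, g) \<in> S x y" using S_total[OF xy f(1)] by blast
    then have "(g, f) \<in> S y x" using S_conv_iff[OF xy] by simp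
    then show ?thesis
      using S_image_coset[OF xy g] S_image_coset[OF EE_sym[OF xy]] S_carrier[OF xy g] f(2)
      by (auto simp: FactGroup_def RCOSETS_def)
  qed
  have bij: "bij_betw (\<lambda>\<xi>. S x y `` \<xi>) (carrier (G x Mod kern x y)) (carrier (G y Mod kern y x))"
    by (rule bij_betw_byWitness[where f' = "\<lambda>\<xi>. S y x `` \<xi>"]) (use closed xy yx in auto)
  have "(\<lambda>\<xi>. S x y `` \<xi>) \<in> hom (G x Mod kern x y) (G y Mod kern y x)"
  proof (rule homI)
    fix \<xi> \<zeta> assume "\<xi> \<in> carrier (G x Mod kern x y)" "\<zeta> \<in> carrier (G x Mod kern x y)"
    then obtain f f' where f: "f \<in> carrier (G x)" "\<xi> = kern x y #>\<^bsub>G x\<^esub> f"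
      and f': "f' \<in> carrier (G x)" "\<zeta> = kern x y #>\<^bsub>G x\<^esub> f'"
      by (auto simp: FactGroup_def RCOSETS_def)
    obtain g where g: "(f, g) \<in> S x y" using S_total[OF xy f(1)] by blast
    obtain g' where g': "(f', g') \<in> S x y" using S_total[OF xy f'(1)] by blast
    show "S x y `` (\<xi> \<otimes>\<^bsub>G x Mod kern x y\<^esub> \<zeta>) = S x y `` \<xi> \<otimes>\<^bsub>G y Mod kern y x\<^esub> S x y `` \<zeta>"
      using f f' g g' S_carrier[OF xy g] S_carrier[OF xy g']
      by (simp add: FactGroup_def X.rcos_sum Y.rcos_sum S_image_coset[OF xy] S_mult[OF xy])
  qed (use closed xy in auto)
  with bij show "(\<lambda>\<xi>. S x y `` \<xi>) \<in> iso (G x Mod kern x y) (G y Mod kern y x)"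
    by (simp add: iso_def)
  assume \<xi>: "\<xi> \<in> carrier (G y Mod kern y x)"
  show "S y x `` \<xi> = inv_into (carrier (G x Mod kern x y)) (\<lambda>\<xi>. S x y `` \<xi>) \<xi>"
    using closed[OF yx \<xi>] bij by (intro inv_into_f_eq[symmetric]) (auto simp: bij_betw_def)
qed

text \<open>\<open>quot_image\<close> collects only the cosets contained in \<open>N\<close>;
  saturation of \<open>N\<close> ensures that the coset of each of its elements is among
  them.\<close>

lemma quot_image_frame:
  assumes xy: "(x, y) \<in> EE" and N: "N \<subseteq> carrier (G x)"
    and closed: "\<And>h n. \<lbrakk>h \<in> kern x y; n \<in> N\<rbrakk> \<Longrightarrow> h \<otimes>\<^bsub>G x\<^esub> n \<in> N"
  shows "quot_image frame x y N = S x y `` N"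
proof -
  have "S x y `` N \<subseteq> quot_image frame x y N"
  proof
    fix g assume "g \<in> S x y `` N"
    then obtain n where n: "n \<in> N" "(n, g) \<in> S x y" by blast
    have "kern x y #>\<^bsub>G x\<^esub> n \<subseteq> N" "kern x y #>\<^bsub>G x\<^esub> n \<in> rcosets\<^bsub>G x\<^esub> kern x y"
      using n N closed by (auto simp: r_coset_def RCOSETS_def)
    moreover have "g \<in> S x y `` (kern x y #>\<^bsub>G x\<^esub> n)"
      using n N by (auto simp: mem_S_image_coset[OF xy])
    ultimately show "g \<in> quot_image frame x y N"
      by (auto simp: quot_image_def frame_def FactGroup_def)
  qed
  then show ?thesis
    by (auto simp: quot_image_def frame_def)
qed

section \<open>The frame conditions\<close>

lemma kern_mult:
  assumes "(x, y) \<in> EE" "(x, z) \<in> EE"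
  shows "subgroup (kern x y <#>\<^bsub>G x\<^esub> kern x z) (G x)"
    and "kern x y \<subseteq> kern x y <#>\<^bsub>G x\<^esub> kern x z" "kern x z \<subseteq> kern x y <#>\<^bsub>G x\<^esub> kern x z"
proof -
  interpret Y: normal "kern x y" "G x" using kern_normal assms by simp
  interpret Z: normal "kern x z" "G x" using kern_normal assms by simp
  show "subgroup (kern x y <#>\<^bsub>G x\<^esub> kern x z) (G x)"
    by (rule Y.mult_norm_subgroup) (rule Y.normal_axioms Z.subgroup_axioms)+
  have "f \<otimes>\<^bsub>G x\<^esub> \<one>\<^bsub>G x\<^esub> \<in> kern x y <#>\<^bsub>G x\<^esub> kern x z" if "f \<in> kern x y" for f
    unfolding set_mult_def by (rule UN_I[OF that], rule UN_I[OF Z.one_closed], rule singletonI)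
  then show "kern x y \<subseteq> kern x y <#>\<^bsub>G x\<^esub> kern x z"
    using Y.mem_carrier by auto
  have "\<one>\<^bsub>G x\<^esub> \<otimes>\<^bsub>G x\<^esub> f \<in> kern x y <#>\<^bsub>G x\<^esub> kern x z" if "f \<in> kern x z" for f
    unfolding set_mult_def
    by (rule UN_I[OF subgroup.one_closed[OF Y.subgroup_axioms]], rule UN_I[OF that], rule singletonI)
  then show "kern x z \<subseteq> kern x y <#>\<^bsub>G x\<^esub> kern x z"
    using Z.mem_carrier by auto
qed

text \<open>A pair from \<open>y\<close> to \<open>z\<close> factors through \<open>x\<close> by
  \<open>S_comp\<close>; for the pair of \<open>k\<close> and the identity, the second factor puts
  the intermediate element in \<open>kern x z\<close>.\<close>

lemma kern_image:
  assumes xy: "(x, y) \<in> EE" and yz: "(y, z) \<in> EE" and k: "k \<in> kern y z"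
  obtains h where "h \<in> kern x z" "(h, k) \<in> S x y"
proof -
  have "(k, \<one>\<^bsub>G z\<^esub>) \<in> S y x O S x z"
    using k S_comp[OF EE_sym[OF xy] EE_trans[OF xy yz]] by (auto simp: kern_def)
  then show thesis
    using that S_conv_iff[OF xy] by (auto simp: kern_def)
qed

text \<open>Frame condition (iii). Forwards, an element of \<open>kern x z\<close> has a partner in
  \<open>kern y z\<close> by \<open>S_comp\<close>, and any other partner differs from it by a
  factor in \<open>kern y x\<close>. Backwards, \<open>kern_image\<close> supplies
  preimages.\<close>

lemma S_image_kern_mult:
  assumes xy: "(x, y) \<in> EE" and yz: "(y, z) \<in> EE"
  shows "S x y `` (kern x y <#>\<^bsub>G x\<^esub> kern x z) = kern y x <#>\<^bsub>G y\<^esub> kern y z"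
proof (intro equalityI subsetI)
  interpret X: group "G x" using group_G EE_I[OF xy] by simp
  interpret Y: group "G y" using group_G EE_I[OF xy] by simp
  {
    fix g assume "g \<in> S x y `` (kern x y <#>\<^bsub>G x\<^esub> kern x z)"
    then obtain a b where a: "(a, \<one>\<^bsub>G y\<^esub>) \<in> S x y" and b: "(b, \<one>\<^bsub>G z\<^esub>) \<in> S x z"
      and g: "(a \<otimes>\<^bsub>G x\<^esub> b, g) \<in> S x y"
      by (auto simp: set_mult_def kern_def)
    obtain k where k: "(b, k) \<in> S x y" "(k, \<one>\<^bsub>G z\<^esub>) \<in> S y z"
      using S_comp[OF xy yz] b by blast
    have c: "b \<in> carrier (G x)" "g \<in> carrier (G y)" "k \<in> carrier (G y)"
      using S_carrier[OF xy g] S_carrier[OF xy k(1)] by auto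
    have "(b, g) \<in> S x y"
      using S_cancel[OF xy a, of b g] g c by simp
    then have "(\<one>\<^bsub>G x\<^esub>, g \<otimes>\<^bsub>G y\<^esub> inv\<^bsub>G y\<^esub> k) \<in> S x y"
      using S_mult[OF xy _ S_inv[OF xy k(1)], of b g] c by simp
    then have "g \<otimes>\<^bsub>G y\<^esub> inv\<^bsub>G y\<^esub> k \<in> kern y x"
      by (simp add: kern_def S_conv_iff[OF xy])
    moreover have "k \<in> kern y z" "g = g \<otimes>\<^bsub>G y\<^esub> inv\<^bsub>G y\<^esub> k \<otimes>\<^bsub>G y\<^esub> k"
      using k c by (simp_all add: kern_def Y.m_assoc)
    ultimately show "g \<in> kern y x <#>\<^bsub>G y\<^esub> kern y z"
      unfolding set_mult_def by blast
  }
  {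
    fix g assume "g \<in> kern y x <#>\<^bsub>G y\<^esub> kern y z"
    then obtain m k where m: "(m, \<one>\<^bsub>G x\<^esub>) \<in> S y x" and k: "k \<in> kern y z" and g: "g = m \<otimes>\<^bsub>G y\<^esub> k"
      by (auto simp: set_mult_def kern_def)
    obtain h where h: "h \<in> kern x z" "(h, k) \<in> S x y"
      using kern_image[OF xy yz k] .
    have "(\<one>\<^bsub>G x\<^esub> \<otimes>\<^bsub>G x\<^esub> h, g) \<in> S x y"
      unfolding g using m h by (intro S_mult[OF xy]) (simp_all add: S_conv_iff[OF xy])
    moreover have "\<one>\<^bsub>G x\<^esub> \<otimes>\<^bsub>G x\<^esub> h \<in> kern x y <#>\<^bsub>G x\<^esub> kern x z"
      using h(1) S_one[OF xy] by (auto simp: set_mult_def kern_def)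
    ultimately show "g \<in> S x y `` (kern x y <#>\<^bsub>G x\<^esub> kern x z)" by blast
  }
qed

text \<open>From right to left this is \<open>S_comp\<close>. From left to right the detour through
  \<open>y\<close> differs from the direct route by an error, which is absorbed in a factor from
  \<open>kern x y\<close> and so stays in \<open>N\<close>.\<close>

lemma S_image_comp:
  assumes xy: "(x, y) \<in> EE" and yz: "(y, z) \<in> EE" and N: "N \<subseteq> carrier (G x)"
    and closed: "\<And>h n. \<lbrakk>h \<in> kern x y; n \<in> N\<rbrakk> \<Longrightarrow> h \<otimes>\<^bsub>G x\<^esub> n \<in> N"
  shows "S y z `` (S x y `` N) = S x z `` N"
proof (intro equalityI subsetI)
  interpret X: group "G x" using group_G EE_I[OF xy] by simp
  interpret Y: group "G y" using group_G EE_I[OF xy] by simp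
  interpret Z: group "G z" using group_G EE_I[OF yz] by simp
  note xz = EE_trans[OF xy yz]
  fix h assume "h \<in> S y z `` (S x y `` N)"
  then obtain f g where f: "f \<in> N" "(f, g) \<in> S x y" and g: "(g, h) \<in> S y z" by blast
  \<comment> \<open>\<open>k\<close> is reached from \<open>f\<close> directly as well as through
    the same \<open>g\<close>, so \<open>h\<close> differs from it by a factor related to the
    identity of \<open>G y\<close>.\<close>
  obtain k where k: "(f, k) \<in> S x z" "(g, k) \<in> S y z"
    using S_comp[OF xz EE_sym[OF yz]] f(2) S_conv_iff[OF yz] by blast
  have c: "f \<in> carrier (G x)" "g \<in> carrier (G y)" "h \<in> carrier (G z)" "k \<in> carrier (G z)"
    using S_carrier[OF xy f(2)] S_carrier[OF yz g] S_carrier[OF xz k(1)] by auto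
  have "(\<one>\<^bsub>G y\<^esub>, h \<otimes>\<^bsub>G z\<^esub> inv\<^bsub>G z\<^esub> k) \<in> S y z"
    using S_mult[OF yz g S_inv[OF yz k(2)]] c by simp
  \<comment> \<open>Going from \<open>y\<close> to \<open>z\<close> through \<open>x\<close> turns
    the error into an element \<open>m\<close> of \<open>kern x y\<close>.\<close>
  then obtain m where m: "(\<one>\<^bsub>G y\<^esub>, m) \<in> S y x" "(m, h \<otimes>\<^bsub>G z\<^esub> inv\<^bsub>G z\<^esub> k) \<in> S x z"
    using S_comp[OF EE_sym[OF xy] xz] by blast
  have "m \<otimes>\<^bsub>G x\<^esub> f \<in> N"
    using m(1) f(1) by (intro closed) (simp_all add: kern_def S_conv_iff[OF xy])
  moreover have "(m \<otimes>\<^bsub>G x\<^esub> f, h) \<in> S x z"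
    using S_mult[OF xz m(2) k(1)] c by (simp add: Z.m_assoc)
  ultimately show "h \<in> S x z `` N" by blast
next
  fix h assume "h \<in> S x z `` N"
  then show "h \<in> S y z `` (S x y `` N)"
    using S_comp[OF xy yz] by blast
qed

theorem is_frame_frame: "is_frame frame"
proof -
  have pair: "is_group_pair frame"
    unfolding is_group_pair_def
    using group_G disjoint_G equiv_EE kern_normal EE_sym S_image_iso(1) by (auto simp: frame_def)
  have refl: "kern x x = {\<one>\<^bsub>G x\<^esub>}" "\<forall>\<xi>\<in>carrier (G x Mod {\<one>\<^bsub>G x\<^esub>}). S x x `` \<xi> = \<xi>"
    if x: "x \<in> I" for x
  proof -
    interpret X: group "G x" using group_G x by simp
    show "kern x x = {\<one>\<^bsub>G x\<^esub>}"
      using x by (auto simp: kern_def S_refl)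
    show "\<forall>\<xi>\<in>carrier (G x Mod {\<one>\<^bsub>G x\<^esub>}). S x x `` \<xi> = \<xi>"
      using x by (auto simp: S_refl FactGroup_def RCOSETS_def r_coset_def)
  qed
  have comp: "quot_image frame x y (kern x y <#>\<^bsub>G x\<^esub> kern x z) = kern y x <#>\<^bsub>G y\<^esub> kern y z"
    "\<forall>N\<in>carrier (G x Mod (kern x y <#>\<^bsub>G x\<^esub> kern x z)).
      quot_image frame y z (quot_image frame x y N) = quot_image frame x z N"
    if xy: "(x, y) \<in> EE" and yz: "(y, z) \<in> EE" for x y z
  proof -
    note xz = EE_trans[OF xy yz]
    define M where "M = kern x y <#>\<^bsub>G x\<^esub> kern x z"
    interpret X: group "G x" using group_G EE_I[OF xy] by simp
    interpret M: subgroup M "G x" unfolding M_def using kern_mult xy xz by simp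
    have kM: "kern x y \<subseteq> M" "kern x z \<subseteq> M" unfolding M_def using kern_mult xy xz by auto
    show "quot_image frame x y (kern x y <#>\<^bsub>G x\<^esub> kern x z) = kern y x <#>\<^bsub>G y\<^esub> kern y z"
      using kM M.subset quot_image_frame[OF xy, of M] S_image_kern_mult[OF xy yz]
      by (auto simp flip: M_def)
    show "\<forall>N\<in>carrier (G x Mod (kern x y <#>\<^bsub>G x\<^esub> kern x z)).
      quot_image frame y z (quot_image frame x y N) = quot_image frame x z N"
      unfolding M_def[symmetric]
    proof
      fix N assume "N \<in> carrier (G x Mod M)"
      then obtain f where f: "f \<in> carrier (G x)" "N = M #>\<^bsub>G x\<^esub> f"
        by (auto simp: FactGroup_def RCOSETS_def)
      have N: "N \<subseteq> carrier (G x)"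
        using f M.subset by (auto simp: r_coset_def)
      have closed: "m \<otimes>\<^bsub>G x\<^esub> n \<in> N" if "m \<in> M" "n \<in> N" for m n
      proof -
        obtain m' where m': "m' \<in> M" "n = m' \<otimes>\<^bsub>G x\<^esub> f"
          using \<open>n \<in> N\<close> f by (auto simp: r_coset_def)
        then have "m \<otimes>\<^bsub>G x\<^esub> n = (m \<otimes>\<^bsub>G x\<^esub> m') \<otimes>\<^bsub>G x\<^esub> f"
          using that f by (simp add: X.m_assoc)
        then show ?thesis
          using m' that f by (auto simp: r_coset_def)
      qed
      have "S x y `` N \<subseteq> carrier (G y)" using S_carrier[OF xy] by blast
      \<comment> \<open>Saturation of the image under \<open>kern y z\<close>, for the outer
        \<open>quot_image\<close>: \<open>kern_image\<close> lifts \<open>k\<close> to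
        \<open>kern x z\<close>, and \<open>N\<close> is closed under factors from there.\<close>
      moreover have "k \<otimes>\<^bsub>G y\<^esub> g \<in> S x y `` N" if k: "k \<in> kern y z" and g: "g \<in> S x y `` N" for k g
      proof -
        obtain h where h: "h \<in> kern x z" "(h, k) \<in> S x y" using kern_image[OF xy yz k] .
        obtain n where n: "n \<in> N" "(n, g) \<in> S x y" using g by blast
        show ?thesis
          using closed[of h n] h n kM S_mult[OF xy h(2) n(2)] by blast
      qed
      ultimately have "quot_image frame y z (S x y `` N) = S y z `` (S x y `` N)"
        by (intro quot_image_frame[OF yz])
      also have "\<dots> = S x z `` N"
        using closed kM N by (intro S_image_comp[OF xy yz]) auto
      also have "\<dots> = quot_image frame x z N"
        using closed kM by (intro quot_image_frame[OF xz N, symmetric]) auto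
      also have "S x y `` N = quot_image frame x y N"
        using closed kM by (intro quot_image_frame[OF xy N, symmetric]) auto
      finally show "quot_image frame y z (quot_image frame x y N) = quot_image frame x z N" .
    qed
  qed
  have "\<forall>(x, y)\<in>EE. \<forall>\<xi>\<in>carrier (G y Mod kern y x). S y x `` \<xi> =
      inv_into (carrier (G x Mod kern x y)) (quot_iso frame x y) \<xi>"
    using S_image_iso(2) by (simp add: frame_def split_def)
  with pair refl comp show ?thesis
    by (simp add: is_frame_def frame_simps split_def)
qed

text \<open>As the image map is a homomorphism, the product of the images of the cosets of
  \<open>f\<close> and \<open>h\<close> is the image of the coset of their product;
  \<open>mem_S_image_coset\<close> then reduces membership to a single pair.\<close>

lemma frame_rel_frame:
  assumes xy: "(x, y) \<in> EE" and h: "h \<in> carrier (G x)"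
  shows "frame_rel frame x y (kern x y #>\<^bsub>G x\<^esub> h) =
    {(f, g). f \<in> carrier (G x) \<and> (f \<otimes>\<^bsub>G x\<^esub> h, g) \<in> S x y}"
proof -
  interpret X: normal "kern x y" "G x" using kern_normal[OF xy] .
  have coset: "g \<in> S x y `` (kern x y #>\<^bsub>G x\<^esub> f) <#>\<^bsub>G y\<^esub> S x y `` (kern x y #>\<^bsub>G x\<^esub> h)
      \<longleftrightarrow> (f \<otimes>\<^bsub>G x\<^esub> h, g) \<in> S x y" if f: "f \<in> carrier (G x)" for f g
  proof -
    have "S x y `` ((kern x y #>\<^bsub>G x\<^esub> f) \<otimes>\<^bsub>G x Mod kern x y\<^esub> (kern x y #>\<^bsub>G x\<^esub> h)) =
      S x y `` (kern x y #>\<^bsub>G x\<^esub> f) \<otimes>\<^bsub>G y Mod kern y x\<^esub> S x y `` (kern x y #>\<^bsub>G x\<^esub> h)"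
      using f h S_image_iso(1)[OF xy]
      by (intro hom_mult) (auto simp: iso_def FactGroup_def RCOSETS_def)
    then show ?thesis
      using f h by (simp add: FactGroup_def X.rcos_sum flip: mem_S_image_coset[OF xy])
  qed
  have "(f, g) \<in> frame_rel frame x y (kern x y #>\<^bsub>G x\<^esub> h) \<longleftrightarrow>
    f \<in> carrier (G x) \<and> (f \<otimes>\<^bsub>G x\<^esub> h, g) \<in> S x y" for f g
  proof
    assume "(f, g) \<in> frame_rel frame x y (kern x y #>\<^bsub>G x\<^esub> h)"
    then obtain f0 where f0: "f0 \<in> carrier (G x)" "f \<in> kern x y #>\<^bsub>G x\<^esub> f0"
      "g \<in> S x y `` (kern x y #>\<^bsub>G x\<^esub> f0) <#>\<^bsub>G y\<^esub> S x y `` (kern x y #>\<^bsub>G x\<^esub> h)"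
      by (auto simp: frame_rel_def frame_def FactGroup_def RCOSETS_def)
    \<comment> \<open>The block comes with an arbitrary representative \<open>f0\<close>;
      \<open>f\<close> represents the same coset.\<close>
    have "kern x y #>\<^bsub>G x\<^esub> f0 = kern x y #>\<^bsub>G x\<^esub> f"
      using X.repr_independence[OF f0(2,1)] X.subgroup_axioms by simp
    moreover have "f \<in> carrier (G x)"
      using f0 X.subset by (auto simp: r_coset_def)
    ultimately show "f \<in> carrier (G x) \<and> (f \<otimes>\<^bsub>G x\<^esub> h, g) \<in> S x y"
      using f0(3) coset by simp
  next
    assume a: "f \<in> carrier (G x) \<and> (f \<otimes>\<^bsub>G x\<^esub> h, g) \<in> S x y"
    then have "f \<in> kern x y #>\<^bsub>G x\<^esub> f" using X.rcos_self X.subgroup_axioms by simp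
    with a show "(f, g) \<in> frame_rel frame x y (kern x y #>\<^bsub>G x\<^esub> h)"
      by (auto simp: frame_rel_def frame_def FactGroup_def RCOSETS_def coset
          intro!: bexI[of _ f])
  qed
  then show ?thesis by auto
qed

end


section \<open>Complete representations of measurable relation algebras\<close>

locale measurable_representation = relation_algebra B for B :: "'a rel_alg" (structure) +
  fixes U :: "'u set" and E :: "'u rel" and \<theta> :: "'a \<Rightarrow> 'u rel"
  assumes measurable: "measurable_rel_alg B"
    and rep: "complete_representation B U E \<theta>"
begin

lemma equiv_E: "equiv U E"
  using rep by (simp add: complete_representation_def)

lemma E_refl: "u \<in> U \<Longrightarrow> (u, u) \<in> E"
  using equiv_E by (auto simp: equiv_def refl_on_def)

lemma E_sym: "(u, v) \<in> E \<Longrightarrow> (v, u) \<in> E"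
  using equiv_E by (auto simp: equiv_def dest: symD)

lemma E_trans: "\<lbrakk>(u, v) \<in> E; (v, w) \<in> E\<rbrakk> \<Longrightarrow> (u, w) \<in> E"
  using equiv_E by (auto simp: equiv_def dest: transD)

lemma E_U: "(u, v) \<in> E \<Longrightarrow> u \<in> U \<and> v \<in> U"
  using equiv_E by (auto simp: equiv_def refl_on_def)

lemma rep_embedding: "\<theta> \<in> ra_embedding B (full_set_rel_alg U E)"
  using rep by (simp add: complete_representation_def)

lemma rep_hom: "\<theta> \<in> ra_hom B (full_set_rel_alg U E)"
  using rep_embedding by (simp add: ra_embedding_def)

lemma rep_subset: "a \<in> carrier B \<Longrightarrow> \<theta> a \<subseteq> E"
  using rep_hom by (auto simp: ra_hom_def full_set_rel_alg_def)

lemma rep_simps [simp]: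
  "\<lbrakk>a \<in> carrier B; b \<in> carrier B\<rbrakk> \<Longrightarrow> \<theta> (a \<^bold>; b) = \<theta> a O \<theta> b"
  "a \<in> carrier B \<Longrightarrow> \<theta> (\<^bold>- a) = E - \<theta> a"
  "a \<in> carrier B \<Longrightarrow> \<theta> (a\<^sup>\<smile>) = (\<theta> a)\<inverse>"
  "\<theta> \<^bold>1' = Id_on U"
  using rep_hom by (simp_all add: ra_hom_def full_set_rel_alg_def)

lemma rep_unit_zero [simp]: "\<theta> \<^bold>1 = E" "\<theta> \<^bold>0 = {}"
  using ra_hom_unit_zero[OF rep_hom] full_set_rel_alg_unit_zero[OF equiv_E] by auto

lemma rep_eq_iff: "\<lbrakk>a \<in> carrier B; b \<in> carrier B\<rbrakk> \<Longrightarrow> \<theta> a = \<theta> b \<longleftrightarrow> a = b"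
  using rep_embedding inj_on_eq_iff[of \<theta> "carrier B" a b] by (simp add: ra_embedding_def)

lemma rep_le_iff: "\<lbrakk>a \<in> carrier B; b \<in> carrier B\<rbrakk> \<Longrightarrow> a \<^bold>\<le> b \<longleftrightarrow> \<theta> a \<subseteq> \<theta> b"
  using ra_embedding_le_iff[OF relation_algebra_axioms rep_embedding, of a b]
  by (auto simp: rle_iff full_set_rel_alg_def)

lemma rep_sum: "\<lbrakk>X \<subseteq> carrier B; is_sum B a X\<rbrakk> \<Longrightarrow> \<theta> a = (\<Union>b\<in>X. \<theta> b)"
  using rep by (simp add: complete_representation_def)

section \<open>Atoms under the complete representation\<close>

lemma atom_subset:
  assumes a: "ra_atom B a" and b: "b \<in> carrier B" and "p \<in> \<theta> a" "p \<in> \<theta> b"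
  shows "\<theta> a \<subseteq> \<theta> b"
  using assms atom_le_neg_iff[OF a b] atom_closed[OF a] by (auto simp: rep_le_iff)

lemma atom_eq: "\<lbrakk>ra_atom B a; ra_atom B b; p \<in> \<theta> a; p \<in> \<theta> b\<rbrakk> \<Longrightarrow> a = b"
  using atom_subset[of a b p] atom_subset[of b a p] atom_closed[of a] atom_closed[of b]
  by (auto simp flip: rep_eq_iff)

lemma atom_nonempty: "ra_atom B a \<Longrightarrow> \<theta> a \<noteq> {}"
  using rep_eq_iff[of a "\<^bold>0"] by (auto simp: ra_atom_def)

text \<open>Preservation of suprema enters here: the elements whose images miss \<open>p\<close>
  cannot have the unit as supremum, since their images do not cover \<open>p\<close>. So they have
  an upper bound \<open>c\<close> other than the unit, and its complement is the atom through
  \<open>p\<close>.\<close>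

lemma ex_atom:
  assumes p: "p \<in> E"
  obtains a where "ra_atom B a" "p \<in> \<theta> a"
proof -
  define X where "X = {b \<in> carrier B. p \<notin> \<theta> b}"
  have X: "X \<subseteq> carrier B" by (auto simp: X_def)
  have "\<not> is_sum B \<^bold>1 X"
    using rep_sum[OF X, of "\<^bold>1"] p by (auto simp: X_def)
  moreover have "b \<^bold>\<le> \<^bold>1" if "b \<in> carrier B" for b
    using that rep_subset by (simp add: rep_le_iff)
  ultimately obtain c where c: "c \<in> carrier B" "\<forall>b\<in>X. b \<^bold>\<le> c" "\<not> \<^bold>1 \<^bold>\<le> c"
    using X unit_closed unfolding is_sum_iff[OF X] Int_absorb2[OF X] by blast
  then have c: "c \<in> carrier B" "\<not> E \<subseteq> \<theta> c" and ub: "\<And>b. b \<in> X \<Longrightarrow> \<theta> b \<subseteq> \<theta> c"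
    using X rep_le_iff[of \<open>\<^bold>1\<close> c] rep_le_iff[of _ c] by auto
  \<comment> \<open>If the complement of \<open>c\<close> missed \<open>p\<close>, it would lie in
    \<open>X\<close>, hence below \<open>c\<close>, and \<open>c\<close> would be the unit.\<close>
  have "p \<in> \<theta> (\<^bold>- c)"
  proof (rule ccontr)
    assume "p \<notin> \<theta> (\<^bold>- c)"
    then have "\<theta> (\<^bold>- c) \<subseteq> \<theta> c" using c(1) by (intro ub) (auto simp: X_def)
    then show False using c by auto
  qed
  \<comment> \<open>If \<open>d\<close> contains \<open>p\<close>, its complement lies in
    \<open>X\<close> and hence below \<open>c\<close>; otherwise \<open>d\<close> itself lies in
    \<open>X\<close> and is below both \<open>c\<close> and its complement.\<close>
  moreover have "d = \<^bold>0 \<or> d = \<^bold>- c" if d: "d \<in> carrier B" "d \<^bold>\<le> \<^bold>- c" for d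
  proof (cases "p \<in> \<theta> d")
    case True
    then have "\<theta> (\<^bold>- d) \<subseteq> \<theta> c" using d by (intro ub) (auto simp: X_def)
    then have "\<theta> d = \<theta> (\<^bold>- c)" using d c(1) by (auto simp: rep_le_iff)
    then show ?thesis using d c(1) by (simp add: rep_eq_iff del: rep_simps)
  next
    case False
    then have "\<theta> d \<subseteq> \<theta> c" using d by (intro ub) (auto simp: X_def)
    then have "\<theta> d = \<theta> \<^bold>0" using d c(1) by (auto simp: rep_le_iff)
    then show ?thesis using d by (simp add: rep_eq_iff del: rep_unit_zero)
  qed
  moreover have "\<^bold>- c \<noteq> \<^bold>0"
    using calculation(1) by (metis rep_unit_zero(2) empty_iff)
  ultimately have "ra_atom B (\<^bold>- c)"
    using c(1) by (simp add: ra_atom_def)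
  then show thesis
    using that \<open>p \<in> \<theta> (\<^bold>- c)\<close> by blast
qed

lemma atomic_B: "atomic B"
  unfolding atomic_def
proof (intro ballI impI)
  fix c assume c: "c \<in> carrier B" "c \<noteq> \<^bold>0"
  then obtain p where p: "p \<in> \<theta> c"
    using rep_eq_iff[of c "\<^bold>0"] by auto
  then obtain a where a: "ra_atom B a" "p \<in> \<theta> a"
    using ex_atom[of p] rep_subset[OF c(1)] by blast
  then have "a \<^bold>\<le> c"
    using c p atom_subset[OF a(1) c(1)] atom_closed[OF a(1)] by (simp add: rep_le_iff)
  with a show "\<exists>a. ra_atom B a \<and> a \<^bold>\<le> c" by blast
qed

text \<open>By \<open>ex_atom\<close> and \<open>atom_eq\<close> the images of the atoms partition
  \<open>E\<close>. So complements of sets of atoms go to complements, and the atom through a pair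
  of a composite lies below the product.\<close>

lemma atom_alg_embedding:
  "(\<lambda>X. \<Union>a\<in>X. \<theta> a) \<in> ra_embedding (atom_alg B) (full_set_rel_alg U E)" (is "?h \<in> _")
proof -
  have sub: "\<theta> a \<subseteq> E" if "ra_atom B a" for a
    using rep_subset atom_closed that by blast
  have "?h \<in> ra_hom (atom_alg B) (full_set_rel_alg U E)"
    unfolding ra_hom_def mem_Collect_eq
  proof (intro conjI ballI)
    show "?h \<in> carrier (atom_alg B) \<rightarrow> carrier (full_set_rel_alg U E)"
      using sub by (auto simp: atom_alg_def full_set_rel_alg_def)
    show "?h (X \<^bold>+\<^bsub>atom_alg B\<^esub> Y) = ?h X \<^bold>+\<^bsub>full_set_rel_alg U E\<^esub> ?h Y" for X Y
      by (auto simp: atom_alg_def full_set_rel_alg_def)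
    show "?h (\<^bold>-\<^bsub>atom_alg B\<^esub> X) = \<^bold>-\<^bsub>full_set_rel_alg U E\<^esub> ?h X"
      if "X \<in> carrier (atom_alg B)" for X
    proof -
      have X: "a \<in> X \<Longrightarrow> ra_atom B a" for a using that by (auto simp: atom_alg_def)
      have "p \<in> (\<Union>a\<in>{a. ra_atom B a} - X. \<theta> a) \<longleftrightarrow> p \<in> E - (\<Union>a\<in>X. \<theta> a)" for p
      proof
        assume "p \<in> (\<Union>a\<in>{a. ra_atom B a} - X. \<theta> a)"
        then obtain a where a: "ra_atom B a" "a \<notin> X" "p \<in> \<theta> a" by blast
        then show "p \<in> E - (\<Union>a\<in>X. \<theta> a)"
          using sub[OF a(1)] atom_eq[OF a(1) X a(3)] by blast
      next
        assume p: "p \<in> E - (\<Union>a\<in>X. \<theta> a)"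
        then obtain a where "ra_atom B a" "p \<in> \<theta> a" using ex_atom[of p] by blast
        with p show "p \<in> (\<Union>a\<in>{a. ra_atom B a} - X. \<theta> a)" by blast
      qed
      then show ?thesis by (simp add: atom_alg_def full_set_rel_alg_def set_eq_iff)
    qed
    show "?h (X \<^bold>;\<^bsub>atom_alg B\<^esub> Y) = ?h X \<^bold>;\<^bsub>full_set_rel_alg U E\<^esub> ?h Y"
      if XY: "X \<in> carrier (atom_alg B)" "Y \<in> carrier (atom_alg B)" for X Y
    proof -
      have at: "\<And>a. a \<in> X \<Longrightarrow> ra_atom B a" "\<And>a. a \<in> Y \<Longrightarrow> ra_atom B a"
        using XY by (auto simp: atom_alg_def)
      have mem: "p \<in> (\<Union>t\<in>{t. ra_atom B t \<and> (\<exists>a\<in>X. \<exists>b\<in>Y. t \<^bold>\<le> a \<^bold>; b)}. \<theta> t)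
        \<longleftrightarrow> (\<exists>a\<in>X. \<exists>b\<in>Y. p \<in> \<theta> a O \<theta> b)" for p
      proof
        assume "p \<in> (\<Union>t\<in>{t. ra_atom B t \<and> (\<exists>a\<in>X. \<exists>b\<in>Y. t \<^bold>\<le> a \<^bold>; b)}. \<theta> t)"
        then obtain t a b where "ra_atom B t" "a \<in> X" "b \<in> Y" "t \<^bold>\<le> a \<^bold>; b" "p \<in> \<theta> t"
          by blast
        then have "p \<in> \<theta> a O \<theta> b"
          using at[THEN atom_closed] atom_closed[of t] by (auto simp: rep_le_iff)
        then show "\<exists>a\<in>X. \<exists>b\<in>Y. p \<in> \<theta> a O \<theta> b"
          using \<open>a \<in> X\<close> \<open>b \<in> Y\<close> by blast
      next
        assume "\<exists>a\<in>X. \<exists>b\<in>Y. p \<in> \<theta> a O \<theta> b"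
        then obtain a b where ab: "a \<in> X" "b \<in> Y" "p \<in> \<theta> a O \<theta> b" by blast
        then have c: "a \<in> carrier B" "b \<in> carrier B" using at atom_closed by blast+
        then have "p \<in> \<theta> (a \<^bold>; b)" "p \<in> E" using ab rep_subset[of "a \<^bold>; b"] by auto
        then obtain t where t: "ra_atom B t" "p \<in> \<theta> t" using ex_atom by blast
        then have "t \<^bold>\<le> a \<^bold>; b"
          using c atom_closed[OF t(1)] atom_subset[OF t(1), of "a \<^bold>; b" p] \<open>p \<in> \<theta> (a \<^bold>; b)\<close>
          by (simp add: rep_le_iff)
        with t ab show "p \<in> (\<Union>t\<in>{t. ra_atom B t \<and> (\<exists>a\<in>X. \<exists>b\<in>Y. t \<^bold>\<le> a \<^bold>; b)}. \<theta> t)"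
          by blast
      qed
      have "(\<Union>t\<in>{t. ra_atom B t \<and> (\<exists>a\<in>X. \<exists>b\<in>Y. t \<^bold>\<le> a \<^bold>; b)}. \<theta> t)
        = (\<Union>a\<in>X. \<theta> a) O (\<Union>b\<in>Y. \<theta> b)"
      proof (rule Set.set_eqI)
        show "p \<in> (\<Union>t\<in>{t. ra_atom B t \<and> (\<exists>a\<in>X. \<exists>b\<in>Y. t \<^bold>\<le> a \<^bold>; b)}. \<theta> t)
          \<longleftrightarrow> p \<in> (\<Union>a\<in>X. \<theta> a) O (\<Union>b\<in>Y. \<theta> b)" for p
          unfolding mem by (cases p) blast
      qed
      then show ?thesis by (simp add: atom_alg_def full_set_rel_alg_def)
    qed
    show "?h (X\<^sup>\<smile>\<^bsub>atom_alg B\<^esub>) = (?h X)\<^sup>\<smile>\<^bsub>full_set_rel_alg U E\<^esub>"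
      if "X \<in> carrier (atom_alg B)" for X
      using that atom_closed by (auto simp: atom_alg_def full_set_rel_alg_def subset_iff)
    have "p \<in> (\<Union>t\<in>{t. ra_atom B t \<and> t \<^bold>\<le> \<^bold>1'}. \<theta> t) \<longleftrightarrow> p \<in> Id_on U" for p
    proof
      assume "p \<in> (\<Union>t\<in>{t. ra_atom B t \<and> t \<^bold>\<le> \<^bold>1'}. \<theta> t)"
      then show "p \<in> Id_on U" using atom_closed by (auto simp: rep_le_iff)
    next
      assume p: "p \<in> Id_on U"
      then obtain t where t: "ra_atom B t" "p \<in> \<theta> t"
        using ex_atom[of p] E_refl by blast
      then have "t \<^bold>\<le> \<^bold>1'"
        using p atom_closed[OF t(1)] atom_subset[OF t(1), of "\<^bold>1'" p] by (simp add: rep_le_iff)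
      with t show "p \<in> (\<Union>t\<in>{t. ra_atom B t \<and> t \<^bold>\<le> \<^bold>1'}. \<theta> t)" by blast
    qed
    then show "?h \<^bold>1'\<^bsub>atom_alg B\<^esub> = \<^bold>1'\<^bsub>full_set_rel_alg U E\<^esub>"
      by (simp add: atom_alg_def full_set_rel_alg_def set_eq_iff)
  qed
  moreover have "inj_on ?h (carrier (atom_alg B))"
  proof
    have *: "X \<subseteq> Y" if X: "X \<subseteq> {a. ra_atom B a}" and Y: "Y \<subseteq> {a. ra_atom B a}"
      and eq: "?h X = ?h Y" for X Y
    proof
      fix a assume a: "a \<in> X"
      then obtain p where p: "p \<in> \<theta> a" using atom_nonempty X by blast
      then obtain b where "b \<in> Y" "p \<in> \<theta> b" using eq a by blast
      then show "a \<in> Y" using atom_eq[of a b p] p a X Y by auto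
    qed
    fix X Y assume "X \<in> carrier (atom_alg B)" "Y \<in> carrier (atom_alg B)" "?h X = ?h Y"
    then show "X = Y" using *[of X Y] *[of Y X] by (simp add: atom_alg_def)
  qed
  ultimately show ?thesis by (simp add: ra_embedding_def)
qed

lemma relation_algebra_atom_alg: "relation_algebra (atom_alg B)"
  by (rule relation_algebra_of_embedding[OF relation_algebra_full_set_rel_alg[OF equiv_E] atom_alg_embedding])
    (auto simp: atom_alg_def atom_conv)

section \<open>Points and arrows of the measurable atoms\<close>

definition ids :: "'a set"
  where "ids = {x. measurable_atom B x}"

definition pts :: "'a \<Rightarrow> 'u set"
  where "pts x = {u. (u, u) \<in> \<theta> x}"

text \<open>For \<open>x\<close> and \<open>y\<close> in \<open>ids\<close> these are the atoms
  below \<open>x;1;y\<close>.\<close>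

definition arr :: "'a \<Rightarrow> 'a \<Rightarrow> 'a set"
  where "arr x y = {t. ra_atom B t \<and> \<theta> t \<subseteq> pts x \<times> pts y}"

lemma ids_atom: "x \<in> ids \<Longrightarrow> ra_atom B x"
  by (simp add: ids_def measurable_atom_def)

lemma ids_closed: "x \<in> ids \<Longrightarrow> x \<in> carrier B"
  using ids_atom atom_closed by blast

lemma rep_ids: "x \<in> ids \<Longrightarrow> \<theta> x = Id_on (pts x)"
  using rep_le_iff[of x "\<^bold>1'"] ids_closed[of x]
  by (auto simp: ids_def measurable_atom_def pts_def Id_on_iff subset_iff)

lemma pts_U: "\<lbrakk>x \<in> ids; u \<in> pts x\<rbrakk> \<Longrightarrow> u \<in> U"
  using rep_subset[OF ids_closed[of x]] E_U by (auto simp: pts_def)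

lemma pts_cover:
  assumes "u \<in> U"
  obtains x where "x \<in> ids" "u \<in> pts x"
proof -
  obtain X where X: "X \<subseteq> ids" "is_sum B \<^bold>1' X"
    using measurable by (auto simp: measurable_rel_alg_def ids_def)
  then have "Id_on U = (\<Union>x\<in>X. \<theta> x)"
    using rep_sum[of X "\<^bold>1'"] ids_closed by auto
  then show thesis
    using that assms X(1) by (auto simp: pts_def)
qed

lemma pts_disjoint: "\<lbrakk>x \<in> ids; y \<in> ids; u \<in> pts x; u \<in> pts y\<rbrakk> \<Longrightarrow> x = y"
  using atom_eq[of x y "(u, u)"] ids_atom by (simp add: pts_def)

lemma pts_nonempty: "x \<in> ids \<Longrightarrow> pts x \<noteq> {}"
  using atom_nonempty[OF ids_atom[of x]] rep_ids[of x] by auto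

lemma arr_atom: "t \<in> arr x y \<Longrightarrow> ra_atom B t"
  by (simp add: arr_def)

lemma arr_closed: "t \<in> arr x y \<Longrightarrow> t \<in> carrier B"
  using arr_atom atom_closed by blast

lemma arr_pts: "\<lbrakk>t \<in> arr x y; (u, v) \<in> \<theta> t\<rbrakk> \<Longrightarrow> u \<in> pts x \<and> v \<in> pts y"
  by (auto simp: arr_def)

text \<open>One pair suffices, because it also lies in the image of \<open>x;t;y\<close>, and an
  atom is contained in any element that it meets.\<close>

lemma arrI:
  assumes t: "ra_atom B t" "(u, v) \<in> \<theta> t" and "u \<in> pts x" "v \<in> pts y" "x \<in> ids" "y \<in> ids"
  shows "t \<in> arr x y"
proof -
  have c: "t \<in> carrier B" "x \<in> carrier B" "y \<in> carrier B"
    using assms ids_closed atom_closed by auto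
  have "\<theta> t \<subseteq> \<theta> (x \<^bold>; t \<^bold>; y)"
    by (rule atom_subset[OF t(1) _ t(2)]) (use assms c in \<open>auto simp: pts_def\<close>)
  then show ?thesis
    using assms c by (auto simp: arr_def rep_ids)
qed

lemma ex_arr:
  assumes "(u, v) \<in> E" "u \<in> pts x" "v \<in> pts y" "x \<in> ids" "y \<in> ids"
  obtains t where "t \<in> arr x y" "(u, v) \<in> \<theta> t"
  using assms ex_atom[of "(u, v)"] arrI by metis

lemma arr_conv: "t \<in> arr x y \<Longrightarrow> t\<^sup>\<smile> \<in> arr y x"
  using atom_closed by (auto simp: arr_def atom_conv)

text \<open>The atom \<open>x\<close> meets the product of \<open>t\<close> with its converse, and
  hence lies below it.\<close>

lemma arr_total:
  assumes t: "t \<in> arr x y" and x: "x \<in> ids" and u: "u \<in> pts x"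
  obtains v where "(u, v) \<in> \<theta> t"
proof -
  have c: "t \<in> carrier B" using t by (rule arr_closed)
  obtain p q where p: "(p, q) \<in> \<theta> t" using atom_nonempty[OF arr_atom[OF t]] by auto
  then have "(p, p) \<in> \<theta> x" using arr_pts[OF t] by (simp add: pts_def)
  then have "\<theta> x \<subseteq> \<theta> (t \<^bold>; t\<^sup>\<smile>)"
    using p c by (intro atom_subset[OF ids_atom[OF x]]) auto
  then show thesis
    using u that c by (auto simp: pts_def)
qed

lemma arr_onto:
  assumes t: "t \<in> arr x y" and "y \<in> ids" "v \<in> pts y"
  obtains u where "(u, v) \<in> \<theta> t"
  using arr_total[OF arr_conv[OF t] assms(2,3)] arr_closed[OF t] by auto

text \<open>This is the only place where the measurability of the atom \<open>x\<close> enters.  Applied to the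
  converse of \<open>f\<close>, it shows that \<open>f\<close> is injective as well.\<close>

lemma arr_function:
  assumes f: "f \<in> arr x x" and x: "x \<in> ids" and uv: "(u, v) \<in> \<theta> f" "(u, w) \<in> \<theta> f"
  shows "v = w"
proof -
  obtain X where X: "X \<subseteq> {f. ra_function B f}" "is_sum B (x \<^bold>; \<^bold>1 \<^bold>; x) X"
    using x by (auto simp: ids_def measurable_atom_def)
  have "\<theta> (x \<^bold>; \<^bold>1 \<^bold>; x) = (\<Union>g\<in>X. \<theta> g)"
    using X by (intro rep_sum) (auto simp: ra_function_def)
  moreover have "(u, v) \<in> \<theta> (x \<^bold>; \<^bold>1 \<^bold>; x)"
    using x uv(1) arr_pts[OF f uv(1)] rep_subset[OF arr_closed[OF f]] ids_closed
    by (auto simp: rep_ids)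
  ultimately obtain g where g: "g \<in> X" "(u, v) \<in> \<theta> g" by blast
  then have gf: "g \<in> carrier B" "g\<^sup>\<smile> \<^bold>; g \<^bold>\<le> \<^bold>1'" using X(1) by (auto simp: ra_function_def)
  have "\<theta> f \<subseteq> \<theta> g"
    using atom_subset[OF arr_atom[OF f] gf(1) uv(1) g(2)] .
  then have "(v, w) \<in> \<theta> (g\<^sup>\<smile> \<^bold>; g)"
    using uv gf(1) by auto
  then have "(v, w) \<in> Id_on U"
    using gf rep_le_iff[of "g\<^sup>\<smile> \<^bold>; g" "\<^bold>1'"] by auto
  then show ?thesis by auto
qed

lemma arr_injective:
  assumes f: "f \<in> arr x x" and x: "x \<in> ids" and "(u, w) \<in> \<theta> f" "(v, w) \<in> \<theta> f"
  shows "u = v"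
  using arr_function[OF arr_conv[OF f] x] assms arr_closed[OF f] by simp

text \<open>Composition with an injective arrow preserves atoms: if an atom \<open>t\<close> shares
  a pair with \<open>f;a\<close>, then \<open>a\<close> lies below the converse of \<open>f\<close>
  times \<open>t\<close>, and injectivity of \<open>f\<close> turns this into \<open>f;a\<close>
  below \<open>t\<close>.\<close>

lemma arr_comp_left:
  assumes f: "f \<in> arr x x" and a: "a \<in> arr x y" and x: "x \<in> ids" and y: "y \<in> ids"
  shows "f \<^bold>; a \<in> arr x y"
proof -
  have c: "f \<in> carrier B" "a \<in> carrier B" using f a arr_closed by auto
  obtain m w where mw: "(m, w) \<in> \<theta> a" using atom_nonempty[OF arr_atom[OF a]] by auto
  obtain u where um: "(u, m) \<in> \<theta> f"
    using arr_onto[OF f x] arr_pts[OF a mw] by blast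
  have uw: "(u, w) \<in> \<theta> (f \<^bold>; a)" using c um mw by auto
  then obtain t where t: "ra_atom B t" "(u, w) \<in> \<theta> t"
    using ex_atom[of "(u, w)"] rep_subset[of "f \<^bold>; a"] c by auto
  have tc: "t \<in> carrier B" using t(1) by (rule atom_closed)
  have "\<theta> a \<subseteq> \<theta> (f\<^sup>\<smile> \<^bold>; t)"
    by (rule atom_subset[OF arr_atom[OF a] _ mw]) (use c tc um t in auto)
  then have at: "\<theta> a \<subseteq> (\<theta> f)\<inverse> O \<theta> t"
    using c tc by simp
  have "\<theta> (f \<^bold>; a) \<subseteq> \<theta> t"
  proof
    fix p assume "p \<in> \<theta> (f \<^bold>; a)"
    then obtain i j k where p: "p = (i, k)" "(i, j) \<in> \<theta> f" "(j, k) \<in> \<theta> a" using c by auto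
    then obtain i' where "(i', j) \<in> \<theta> f" "(i', k) \<in> \<theta> t" using at by blast
    then show "p \<in> \<theta> t" using p arr_injective[OF f x p(2)] by simp
  qed
  moreover have "\<theta> t \<subseteq> \<theta> (f \<^bold>; a)"
    using c uw by (intro atom_subset[OF t(1) _ t(2)]) auto
  ultimately have "f \<^bold>; a = t"
    using c tc by (auto simp flip: rep_eq_iff)
  then show ?thesis
    using arrI[OF t _ _ x y] arr_pts[OF f um] arr_pts[OF a mw] by simp
qed

lemma arr_comp_right:
  assumes "a \<in> arr x y" "g \<in> arr y y" "x \<in> ids" "y \<in> ids"
  shows "a \<^bold>; g \<in> arr x y"
proof -
  have "(g\<^sup>\<smile> \<^bold>; a\<^sup>\<smile>)\<^sup>\<smile> \<in> arr x y"
    using assms by (intro arr_conv arr_comp_left) auto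
  then show ?thesis
    using assms arr_closed by (simp add: conv_comp conv_conv)
qed

lemma ids_arr: "x \<in> ids \<Longrightarrow> x \<in> arr x x"
  using rep_ids[of x] ids_atom[of x] by (auto simp: arr_def)

section \<open>The group of arrows at an atom\<close>

definition arr_group :: "'a \<Rightarrow> 'a monoid"
  where "arr_group x = \<lparr>carrier = arr x x, mult = (\<lambda>f g. f \<^bold>; g), one = x\<rparr>"

lemma arr_group_simps [simp]:
  "carrier (arr_group x) = arr x x" "f \<otimes>\<^bsub>arr_group x\<^esub> g = f \<^bold>; g" "\<one>\<^bsub>arr_group x\<^esub> = x"
  by (simp_all add: arr_group_def)

lemma arr_left_id:
  assumes "x \<in> ids" "a \<in> arr x y" shows "x \<^bold>; a = a"
proof -
  have "\<theta> (x \<^bold>; a) = \<theta> a"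
    using assms ids_closed arr_closed arr_pts[OF assms(2)]
    by (auto simp: rep_ids intro: relcompI[OF Id_onI])
  then show ?thesis
    using assms ids_closed arr_closed by (simp add: rep_eq_iff del: rep_simps)
qed

text \<open>Both sides are atoms, so a common pair is enough.\<close>

lemma arr_conv_comp:
  assumes x: "x \<in> ids" and f: "f \<in> arr x x" shows "f\<^sup>\<smile> \<^bold>; f = x"
proof -
  obtain u v where uv: "(u, v) \<in> \<theta> f" using atom_nonempty[OF arr_atom[OF f]] by auto
  show ?thesis
  proof (rule atom_eq)
    show "ra_atom B (f\<^sup>\<smile> \<^bold>; f)"
      using x f by (blast intro: arr_atom arr_comp_left arr_conv)
    show "(v, v) \<in> \<theta> (f\<^sup>\<smile> \<^bold>; f)" using uv arr_closed[OF f] by auto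
    show "(v, v) \<in> \<theta> x" using arr_pts[OF f uv] by (simp add: pts_def)
  qed (rule ids_atom[OF x])
qed

lemma group_arr_group: "group (arr_group x)" if x: "x \<in> ids"
proof (rule groupI)
  show "\<exists>g\<in>carrier (arr_group x). g \<otimes>\<^bsub>arr_group x\<^esub> f = \<one>\<^bsub>arr_group x\<^esub>"
    if "f \<in> carrier (arr_group x)" for f
    using that x by (auto intro!: bexI[of _ "f\<^sup>\<smile>"] arr_conv_comp arr_conv)
qed (use x in \<open>auto intro: arr_comp_left ids_arr arr_left_id simp: comp_assoc arr_closed\<close>)

lemma inv_arr_group: "\<lbrakk>x \<in> ids; f \<in> arr x x\<rbrakk> \<Longrightarrow> inv\<^bsub>arr_group x\<^esub> f = f\<^sup>\<smile>"
  by (rule group.inv_equality[OF group_arr_group]) (auto intro: arr_conv_comp arr_conv)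

text \<open>For members of \<open>ids\<close> this says that \<open>x;1;y\<close> is
  nonzero.\<close>

definition linked :: "'a rel"
  where "linked = {(x, y). x \<in> ids \<and> y \<in> ids \<and> (\<exists>u\<in>pts x. \<exists>v\<in>pts y. (u, v) \<in> E)}"

text \<open>A pair in \<open>E\<close> between the two point sets lies in an arrow, and arrows are
  total by \<open>arr_total\<close>.\<close>

lemma linked_total:
  assumes xy: "(x, y) \<in> linked" and u: "u \<in> pts x"
  obtains v where "v \<in> pts y" "(u, v) \<in> E"
proof -
  obtain p q where "p \<in> pts x" "q \<in> pts y" "(p, q) \<in> E" and I: "x \<in> ids" "y \<in> ids"
    using xy by (auto simp: linked_def)
  then obtain t where t: "t \<in> arr x y" using ex_arr by blast
  obtain v where v: "(u, v) \<in> \<theta> t" using arr_total[OF t I(1) u] .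
  show thesis
    using that[of v] v arr_pts[OF t v] rep_subset[OF arr_closed[OF t]] by blast
qed

lemma equiv_linked: "equiv ids linked"
proof (rule equivI)
  show "linked \<subseteq> ids \<times> ids" by (auto simp: linked_def)
  show "refl_on ids linked"
  proof (rule refl_onI)
    fix x assume x: "x \<in> ids"
    then show "(x, x) \<in> linked"
      using pts_nonempty[OF x] pts_U[OF x] E_refl by (fastforce simp: linked_def)
  qed
  show "sym linked"
    using E_sym by (fastforce simp: linked_def sym_def)
  show "trans linked"
  proof (rule transI)
    fix x y z assume xy: "(x, y) \<in> linked" and yz: "(y, z) \<in> linked"
    then obtain u v where uv: "u \<in> pts x" "v \<in> pts y" "(u, v) \<in> E"
      by (auto simp: linked_def)
    obtain w where w: "w \<in> pts z" "(v, w) \<in> E" using linked_total[OF yz uv(2)] .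
    have "(u, w) \<in> E" using E_trans[OF uv(3) w(2)] .
    then show "(x, z) \<in> linked"
      using uv(1) w(1) xy yz unfolding linked_def by blast
  qed
qed

lemma linked_sym: "(x, y) \<in> linked \<Longrightarrow> (y, x) \<in> linked"
  using equiv_linked by (auto simp: equiv_def dest: symD)

lemma linked_trans: "\<lbrakk>(x, y) \<in> linked; (y, z) \<in> linked\<rbrakk> \<Longrightarrow> (x, z) \<in> linked"
  using equiv_linked by (auto simp: equiv_def dest: transD)

text \<open>Base points within one linked class are made compatible by transporting a single point
  of the class to each \<open>pts x\<close> with \<open>linked_total\<close>.\<close>

lemma ex_base_points:
  "\<exists>b. (\<forall>x\<in>ids. b x \<in> pts x) \<and> (\<forall>(x, y)\<in>linked. (b x, b y) \<in> E)"
proof -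
  \<comment> \<open>The choice depends only on the class of \<open>x\<close>, so linked atoms get
    the same root and the same point \<open>r\<close>.\<close>
  define root where "root x = (SOME y. (x, y) \<in> linked)" for x
  define r where "r x = (SOME u. u \<in> pts (root x))" for x
  have root: "(x, root x) \<in> linked" if "x \<in> ids" for x
    unfolding root_def by (rule someI[of _ x]) (use that equiv_linked in \<open>auto simp: equiv_def refl_on_def\<close>)
  have r: "r x \<in> pts (root x)" if "x \<in> ids" for x
    using root[OF that] pts_nonempty[of "root x"] unfolding r_def some_in_eq by (auto simp: linked_def)
  have "\<exists>u. u \<in> pts x \<and> (r x, u) \<in> E" if "x \<in> ids" for x
    using linked_total[OF linked_sym[OF root[OF that]] r[OF that]] by blast
  then obtain b where b: "\<And>x. x \<in> ids \<Longrightarrow> b x \<in> pts x \<and> (r x, b x) \<in> E" by metis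
  have "(b x, b y) \<in> E" if xy: "(x, y) \<in> linked" for x y
  proof -
    have I: "x \<in> ids" "y \<in> ids" using xy by (auto simp: linked_def)
    have "(x, z) \<in> linked \<longleftrightarrow> (y, z) \<in> linked" for z
      using xy linked_sym linked_trans by blast
    then have "r x = r y" by (simp add: r_def root_def)
    then show ?thesis using b[OF I(1)] b[OF I(2)] E_trans E_sym by (metis (full_types))
  qed
  with b show ?thesis by blast
qed

end

section \<open>The regular action on base points\<close>

locale based_representation = measurable_representation +
  fixes b :: "'a \<Rightarrow> 'b"
  assumes base_pts: "x \<in> ids \<Longrightarrow> b x \<in> pts x"
    and base_linked: "(x, y) \<in> linked \<Longrightarrow> (b x, b y) \<in> E"
begin

definition cell :: "'a \<Rightarrow> 'a \<Rightarrow> 'a"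
  where "cell x y = (THE t. ra_atom B t \<and> (b x, b y) \<in> \<theta> t)"

text \<open>For linked \<open>x\<close> and \<open>y\<close> this is the stabiliser of
  \<open>cell x y\<close> when \<open>(f, g)\<close> acts by composing with the converse of
  \<open>f\<close> on the left and with \<open>g\<close> on the right.\<close>

definition stab :: "'a \<Rightarrow> 'a \<Rightarrow> 'a rel"
  where "stab x y = {(f, g). f \<in> arr x x \<and> g \<in> arr y y \<and> f \<^bold>; cell x y = cell x y \<^bold>; g}"

text \<open>The regular action of the groups: \<open>f \<in> arr x x\<close> is identified with the image of the base
  point \<open>b x\<close> under \<open>f\<close>.\<close>

definition orb :: "('a \<times> 'b) set"
  where "orb = {(f, v). \<exists>x\<in>ids. f \<in> arr x x \<and> (b x, v) \<in> \<theta> f}"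

definition pull :: "'b rel \<Rightarrow> 'a rel"
  where "pull R = {(f, g). \<exists>v w. (f, v) \<in> orb \<and> (g, w) \<in> orb \<and> (v, w) \<in> R}"

lemma linked_ids: "(x, y) \<in> linked \<Longrightarrow> x \<in> ids \<and> y \<in> ids"
  by (auto simp: linked_def)

lemma cell_eq: "\<lbrakk>ra_atom B t; (b x, b y) \<in> \<theta> t\<rbrakk> \<Longrightarrow> cell x y = t"
  unfolding cell_def by (rule the_equality) (auto dest: atom_eq)

lemma cell:
  assumes xy: "(x, y) \<in> linked"
  shows "(b x, b y) \<in> \<theta> (cell x y)" "cell x y \<in> arr x y"
proof -
  have I: "x \<in> ids" "y \<in> ids" using linked_ids[OF xy] by auto
  obtain t where t: "t \<in> arr x y" "(b x, b y) \<in> \<theta> t"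
    using ex_arr[OF base_linked[OF xy] base_pts base_pts] I by blast
  then have "cell x y = t" using cell_eq arr_atom by blast
  with t show "(b x, b y) \<in> \<theta> (cell x y)" "cell x y \<in> arr x y" by auto
qed

lemma arr_inter: "\<lbrakk>t \<in> arr x y; t \<in> arr x' y'; x \<in> ids; y \<in> ids; x' \<in> ids; y' \<in> ids\<rbrakk> \<Longrightarrow> x = x' \<and> y = y'"
  using atom_nonempty[OF arr_atom[of t x y]] arr_pts[of t] pts_disjoint by fast

lemma orb_iff: "\<lbrakk>x \<in> ids; f \<in> arr x x\<rbrakk> \<Longrightarrow> (f, v) \<in> orb \<longleftrightarrow> (b x, v) \<in> \<theta> f"
  unfolding orb_def using arr_inter[of f x x] by blast

lemma orb_function: "\<lbrakk>(f, v) \<in> orb; (f, w) \<in> orb\<rbrakk> \<Longrightarrow> v = w"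
  using arr_function orb_iff unfolding orb_def by blast

lemma orb_injective:
  assumes "(f, v) \<in> orb" "(g, v) \<in> orb" shows "f = g"
proof -
  obtain x y where x: "x \<in> ids" "f \<in> arr x x" "(b x, v) \<in> \<theta> f"
    and y: "y \<in> ids" "g \<in> arr y y" "(b y, v) \<in> \<theta> g"
    using assms by (auto simp: orb_def)
  have "x = y"
    using pts_disjoint x y arr_pts by blast
  then show ?thesis using x y arr_atom atom_eq by blast
qed

lemma orb_total:
  assumes "x \<in> ids" "f \<in> arr x x"
  obtains v where "(f, v) \<in> orb" "v \<in> pts x" "(b x, v) \<in> E"
proof -
  obtain v where v: "(b x, v) \<in> \<theta> f"
    using arr_total[OF assms(2,1) base_pts[OF assms(1)]] .
  show thesis
    using that[of v] v orb_iff[OF assms] arr_pts[OF assms(2) v] rep_subset[OF arr_closed[OF assms(2)]]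
    by blast
qed

lemma orb_onto:
  assumes "x \<in> ids" "v \<in> pts x" "(b x, v) \<in> E"
  obtains f where "f \<in> arr x x" "(f, v) \<in> orb"
  using ex_arr[OF assms(3) base_pts[OF assms(1)] assms(2,1,1)] orb_iff[OF assms(1)] by blast

text \<open>Base points of linked atoms are related, so the range of \<open>orb\<close> is a union
  of classes of \<open>E\<close>; this is what lets \<open>pull\<close> preserve
  composition.\<close>

lemma orb_closed:
  assumes f: "(f, v) \<in> orb" and vw: "(v, w) \<in> E"
  obtains g where "(g, w) \<in> orb"
proof -
  obtain x where x: "x \<in> ids" "f \<in> arr x x" "(b x, v) \<in> \<theta> f"
    using f by (auto simp: orb_def)
  then have v: "v \<in> pts x" "(b x, v) \<in> E" using arr_pts rep_subset[OF arr_closed] by blast+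
  obtain y where y: "y \<in> ids" "w \<in> pts y"
    using pts_cover E_U[OF vw] by blast
  have "(x, y) \<in> linked" using x(1) y v(1) vw unfolding linked_def by blast
  then have "(b y, w) \<in> E"
    using base_linked E_sym E_trans v(2) vw by blast
  then show thesis using that orb_onto[OF y] by blast
qed

text \<open>\<open>f;cell x y\<close> and \<open>cell x y;g\<close> are atoms, so they are equal as
  soon as both contain \<open>(b x, w)\<close>. The second contains it by the choice of
  \<open>w\<close>; the first does exactly when the cell relates \<open>v\<close> to
  \<open>w\<close>.\<close>

lemma stab_iff:
  assumes xy: "(x, y) \<in> linked" and f: "f \<in> arr x x" "(f, v) \<in> orb" and g: "g \<in> arr y y" "(g, w) \<in> orb"
  shows "(f, g) \<in> stab x y \<longleftrightarrow> (v, w) \<in> \<theta> (cell x y)"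
proof -
  note I = linked_ids[OF xy, THEN conjunct1] linked_ids[OF xy, THEN conjunct2]
  note a = cell[OF xy]
  have c: "f \<in> carrier B" "g \<in> carrier B" "cell x y \<in> carrier B"
    using f g a arr_closed by auto
  have fv: "(b x, v) \<in> \<theta> f" and gw: "(b y, w) \<in> \<theta> g"
    using f g I orb_iff by auto
  have ag: "(b x, w) \<in> \<theta> (cell x y \<^bold>; g)" using a gw c by auto
  show ?thesis
  proof
    assume "(f, g) \<in> stab x y"
    then have "(b x, w) \<in> \<theta> (f \<^bold>; cell x y)" using ag by (simp add: stab_def)
    then obtain v' where "(b x, v') \<in> \<theta> f" "(v', w) \<in> \<theta> (cell x y)" using c by auto
    then show "(v, w) \<in> \<theta> (cell x y)" using arr_function[OF f(1) I(1) fv] by simp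
  next
    assume "(v, w) \<in> \<theta> (cell x y)"
    then have "(b x, w) \<in> \<theta> (f \<^bold>; cell x y)" using fv c by auto
    then have "f \<^bold>; cell x y = cell x y \<^bold>; g"
      using ag by (intro atom_eq) (auto intro: arr_atom arr_comp_left arr_comp_right f g a I)
    then show "(f, g) \<in> stab x y" using f g by (simp add: stab_def)
  qed
qed

lemma arr_right_id:
  assumes "y \<in> ids" "a \<in> arr x y" shows "a \<^bold>; y = a"
proof -
  have "\<theta> (a \<^bold>; y) = \<theta> a"
    using assms ids_closed arr_closed arr_pts[OF assms(2)]
    by (auto simp: rep_ids intro: relcompI[OF _ Id_onI])
  then show ?thesis
    using assms ids_closed arr_closed by (simp add: rep_eq_iff del: rep_simps)
qed

lemma arr_comp_conv: "\<lbrakk>x \<in> ids; f \<in> arr x x\<rbrakk> \<Longrightarrow> f \<^bold>; f\<^sup>\<smile> = x"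
  using arr_conv_comp[OF _ arr_conv[of f x x]] arr_closed[of f x x] by (simp add: conv_conv)

text \<open>Products and inverses are computed in the algebra; totality, converse and composition
  are read off from points with \<open>stab_iff\<close>.\<close>

lemma subdirect_system_stab: "subdirect_system ids linked arr_group stab"
proof (rule subdirect_system.intro)
  show "group (arr_group x)" if "x \<in> ids" for x using group_arr_group that .
  show "disjoint_family_on (\<lambda>x. carrier (arr_group x)) ids"
    unfolding disjoint_family_on_def using arr_inter by auto
  show "equiv ids linked" by (rule equiv_linked)
  show "f \<in> carrier (arr_group x) \<and> g \<in> carrier (arr_group y)" if "(f, g) \<in> stab x y" for x y f g
    using that by (simp add: stab_def)
  show "(f \<otimes>\<^bsub>arr_group x\<^esub> f', g \<otimes>\<^bsub>arr_group y\<^esub> g') \<in> stab x y"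
    if xy: "(x, y) \<in> linked" and "(f, g) \<in> stab x y" "(f', g') \<in> stab x y" for x y f g f' g'
  proof -
    note I = linked_ids[OF xy, THEN conjunct1] linked_ids[OF xy, THEN conjunct2]
    note [simp] = arr_closed[OF cell(2)[OF xy]]
    have f: "f \<in> arr x x" "g \<in> arr y y" "f \<^bold>; cell x y = cell x y \<^bold>; g"
      and f': "f' \<in> arr x x" "g' \<in> arr y y" "f' \<^bold>; cell x y = cell x y \<^bold>; g'"
      using that by (auto simp: stab_def)
    note [simp] = f(1,2)[THEN arr_closed] f'(1,2)[THEN arr_closed]
    have "f \<^bold>; f' \<^bold>; cell x y = f \<^bold>; (f' \<^bold>; cell x y)" by (rule comp_assoc[symmetric]) auto
    also have "\<dots> = (f \<^bold>; cell x y) \<^bold>; g'" by (simp add: f'(3) comp_assoc)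
    also have "\<dots> = cell x y \<^bold>; (g \<^bold>; g')" by (simp add: f(3) comp_assoc)
    finally show ?thesis
      using f f' I by (simp add: stab_def arr_comp_left)
  qed
  show "(inv\<^bsub>arr_group x\<^esub> f, inv\<^bsub>arr_group y\<^esub> g) \<in> stab x y"
    if xy: "(x, y) \<in> linked" and "(f, g) \<in> stab x y" for x y f g
  proof -
    note I = linked_ids[OF xy, THEN conjunct1] linked_ids[OF xy, THEN conjunct2]
    note a = cell(2)[OF xy]
    have f: "f \<in> arr x x" "g \<in> arr y y" "f \<^bold>; cell x y = cell x y \<^bold>; g"
      using that by (auto simp: stab_def)
    note [simp] = f(1,2)[THEN arr_closed] arr_closed[OF a]
    have "f\<^sup>\<smile> \<^bold>; cell x y = f\<^sup>\<smile> \<^bold>; (cell x y \<^bold>; (g \<^bold>; g\<^sup>\<smile>))"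
      by (simp add: arr_comp_conv[OF I(2) f(2)] arr_right_id[OF I(2) a])
    also have "\<dots> = f\<^sup>\<smile> \<^bold>; (f \<^bold>; cell x y) \<^bold>; g\<^sup>\<smile>"
      by (simp add: f(3) comp_assoc)
    also have "\<dots> = (f\<^sup>\<smile> \<^bold>; f) \<^bold>; cell x y \<^bold>; g\<^sup>\<smile>"
      by (subst comp_assoc) auto
    also have "\<dots> = cell x y \<^bold>; g\<^sup>\<smile>"
      by (simp add: arr_conv_comp[OF I(1) f(1)] arr_left_id[OF I(1) a])
    finally show ?thesis
      using f I by (simp add: stab_def inv_arr_group arr_conv)
  qed
  show "\<exists>g. (f, g) \<in> stab x y" if xy: "(x, y) \<in> linked" and "f \<in> carrier (arr_group x)" for x y f
  proof -
    note I = linked_ids[OF xy, THEN conjunct1] linked_ids[OF xy, THEN conjunct2]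
    note a = cell[OF xy]
    have f: "f \<in> arr x x" using that by simp
    obtain v where v: "(f, v) \<in> orb" "v \<in> pts x" "(b x, v) \<in> E" using orb_total[OF I(1) f] .
    \<comment> \<open>Follow \<open>f\<close> from the base point and then the cell; the endpoint is
      related to \<open>b y\<close> and is thus reached from it by some \<open>g\<close>.\<close>
    obtain w where w: "(v, w) \<in> \<theta> (cell x y)" using arr_total[OF a(2) I(1) v(2)] .
    then have "(v, w) \<in> E" "w \<in> pts y" using arr_pts[OF a(2)] rep_subset[OF arr_closed[OF a(2)]] by auto
    moreover have "(b y, v) \<in> E" using E_trans[OF E_sym[OF base_linked[OF xy]] v(3)] .
    ultimately obtain g where "g \<in> arr y y" "(g, w) \<in> orb"
      using orb_onto[OF I(2)] E_trans by blast
    then show ?thesis using stab_iff[OF xy f v(1)] w by blast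
  qed
  show "stab x x = Id_on (carrier (arr_group x))" if x: "x \<in> ids" for x
  proof -
    have "cell x x = x"
      using x base_pts[OF x] by (intro cell_eq ids_atom) (auto simp: rep_ids)
    then show ?thesis
      using x by (auto simp: stab_def arr_left_id arr_right_id)
  qed
  show conv: "stab y x = (stab x y)\<inverse>" if xy: "(x, y) \<in> linked" for x y
  proof -
    note I = linked_ids[OF xy, THEN conjunct1] linked_ids[OF xy, THEN conjunct2]
    note a = cell[OF xy]
    \<comment> \<open>The converse of \<open>cell x y\<close> is an atom through the reversed base
      pair, and there is only one.\<close>
    have "cell y x = (cell x y)\<^sup>\<smile>"
      using a arr_closed[OF a(2)] by (intro cell_eq) (auto intro: arr_atom arr_conv)
    then have conv: "(w, v) \<in> \<theta> (cell y x) \<longleftrightarrow> (v, w) \<in> \<theta> (cell x y)" for v w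
      using arr_closed[OF a(2)] by simp
    have "(g, f) \<in> stab y x \<longleftrightarrow> (f, g) \<in> stab x y" for f g
    proof (cases "f \<in> arr x x \<and> g \<in> arr y y")
      case True
      then obtain v w where "(f, v) \<in> orb" "(g, w) \<in> orb" using orb_total I by metis
      then show ?thesis
        using True conv stab_iff[OF xy, of f v g w] stab_iff[OF linked_sym[OF xy], of g w f v] by simp
    qed (auto simp: stab_def)
    then show ?thesis by auto
  qed
  show "stab x z \<subseteq> stab x y O stab y z" if xy: "(x, y) \<in> linked" and yz: "(y, z) \<in> linked" for x y z
  proof
    note xz = linked_trans[OF xy yz]
    have I: "x \<in> ids" "y \<in> ids" "z \<in> ids" using linked_ids xy yz by auto
    fix p assume "p \<in> stab x z"
    then obtain f h where p: "p = (f, h)" "(f, h) \<in> stab x z" "f \<in> arr x x" "h \<in> arr z z"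
      by (auto simp: stab_def)
    obtain v where v: "(f, v) \<in> orb" "v \<in> pts x" "(b x, v) \<in> E" using orb_total[OF I(1) p(3)] .
    obtain u where u: "(h, u) \<in> orb" using orb_total[OF I(3) p(4)] .
    have c: "cell x y \<in> carrier B" "cell y z \<in> carrier B"
      using cell(2)[OF xy] cell(2)[OF yz] arr_closed by auto
    \<comment> \<open>The pair of base points factors through \<open>b y\<close>, so the atom
      through it lies below the product of the two cells.\<close>
    have "\<theta> (cell x z) \<subseteq> \<theta> (cell x y \<^bold>; cell y z)"
      using c cell[OF xz] cell(1)[OF xy] cell(1)[OF yz]
      by (intro atom_subset[where p = "(b x, b z)"]) (auto intro: arr_atom)
    moreover have "(v, u) \<in> \<theta> (cell x z)"
      using stab_iff[OF xz p(3) v(1) p(4) u] p(2) by simp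
    ultimately obtain w where w: "(v, w) \<in> \<theta> (cell x y)" "(w, u) \<in> \<theta> (cell y z)"
      using c by auto
    have "w \<in> pts y" "(v, w) \<in> E"
      using w(1) arr_pts[OF cell(2)[OF xy]] rep_subset[OF c(1)] by auto
    moreover have "(b y, v) \<in> E" using E_trans[OF E_sym[OF base_linked[OF xy]] v(3)] .
    ultimately obtain g where g: "g \<in> arr y y" "(g, w) \<in> orb"
      using orb_onto[OF I(2)] E_trans by blast
    then show "p \<in> stab x y O stab y z"
      using p w stab_iff[OF xy p(3) v(1) g] stab_iff[OF yz g p(4) u] by blast
  qed
qed

section \<open>Transport to the group relation algebra\<close>

sublocale subdirect_system ids linked arr_group stab
  by (rule subdirect_system_stab)

text \<open>By \<open>frame_rel_frame\<close>, a pair \<open>(f, g)\<close> is in the block relation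
  when \<open>(f;h, g)\<close> is in \<open>stab x y\<close>. As \<open>f;h\<close> reaches the
  image under \<open>h\<close> of the point of \<open>f\<close>, \<open>stab_iff\<close> turns this
  into a path along \<open>h\<close> and then along the cell.\<close>

lemma frame_rel_eq_pull:
  assumes xy: "(x, y) \<in> linked" and h: "h \<in> arr x x"
  shows "frame_rel frame x y (kern x y #>\<^bsub>arr_group x\<^esub> h) = pull (\<theta> (h \<^bold>; cell x y))"
proof -
  note I = linked_ids[OF xy, THEN conjunct1] linked_ids[OF xy, THEN conjunct2]
  note a = cell[OF xy]
  have c: "h \<in> carrier B" "cell x y \<in> carrier B" using h a arr_closed by auto
  have key: "(f \<^bold>; h, g) \<in> stab x y \<longleftrightarrow> (v, w) \<in> \<theta> (h \<^bold>; cell x y)"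
    if f: "f \<in> arr x x" "(f, v) \<in> orb" and g: "g \<in> arr y y" "(g, w) \<in> orb" for f g v w
  proof -
    have v: "(b x, v) \<in> \<theta> f" using f I orb_iff by simp
    then have "v \<in> pts x" using arr_pts[OF f(1)] by blast
    then obtain v' where v': "(v, v') \<in> \<theta> h" using arr_total[OF h I(1)] by blast
    have fh: "f \<^bold>; h \<in> arr x x" using arr_comp_left[OF f(1) h I(1) I(1)] .
    have "(b x, v') \<in> \<theta> (f \<^bold>; h)" using v v' c arr_closed[OF f(1)] by auto
    then have "(f \<^bold>; h, v') \<in> orb" using orb_iff[OF I(1) fh] by simp
    then have "(f \<^bold>; h, g) \<in> stab x y \<longleftrightarrow> (v', w) \<in> \<theta> (cell x y)"
      using stab_iff[OF xy fh _ g] by simp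
    also have "\<dots> \<longleftrightarrow> (\<exists>m. (v, m) \<in> \<theta> h \<and> (m, w) \<in> \<theta> (cell x y))"
      using v' arr_function[OF h I(1) v'] by blast
    also have "\<dots> \<longleftrightarrow> (v, w) \<in> \<theta> (h \<^bold>; cell x y)"
      using c by auto
    finally show ?thesis .
  qed
  have "(f, g) \<in> frame_rel frame x y (kern x y #>\<^bsub>arr_group x\<^esub> h) \<longleftrightarrow> (f, g) \<in> pull (\<theta> (h \<^bold>; cell x y))" for f g
  proof
    assume "(f, g) \<in> frame_rel frame x y (kern x y #>\<^bsub>arr_group x\<^esub> h)"
    then have fg: "f \<in> arr x x" "(f \<^bold>; h, g) \<in> stab x y" using frame_rel_frame[OF xy, of h] h by auto
    then have g: "g \<in> arr y y" by (simp add: stab_def)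
    obtain v w where "(f, v) \<in> orb" "(g, w) \<in> orb" using orb_total I fg(1) g by metis
    then show "(f, g) \<in> pull (\<theta> (h \<^bold>; cell x y))"
      using key[OF fg(1) _ g] fg(2) unfolding pull_def by blast
  next
    assume "(f, g) \<in> pull (\<theta> (h \<^bold>; cell x y))"
    then obtain v w where vw: "(f, v) \<in> orb" "(g, w) \<in> orb" "(v, w) \<in> \<theta> (h \<^bold>; cell x y)"
      by (auto simp: pull_def)
    obtain x' y' where f: "x' \<in> ids" "f \<in> arr x' x'" and g: "y' \<in> ids" "g \<in> arr y' y'"
      using vw by (auto simp: orb_def)
    \<comment> \<open>\<open>pull\<close> carries no indices; they are recovered from the
      disjointness of the point sets.\<close>
    have "v \<in> pts x'" "w \<in> pts y'" using f g vw orb_iff arr_pts by blast+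
    moreover have "v \<in> pts x" "w \<in> pts y"
      using arr_pts[OF arr_comp_left[OF h a(2) I] vw(3)] by auto
    ultimately have "x' = x" "y' = y" using pts_disjoint f g I by blast+
    then show "(f, g) \<in> frame_rel frame x y (kern x y #>\<^bsub>arr_group x\<^esub> h)"
      using key f g vw frame_rel_frame[OF xy, of h] h by auto
  qed
  then show ?thesis by auto
qed

text \<open>Follow \<open>t\<close> from the base point \<open>b x\<close> and return along the
  cell; if \<open>h\<close> is the arrow from \<open>b x\<close> to the point so reached, the atoms
  \<open>t\<close> and \<open>h;cell x y\<close> share a pair.\<close>

lemma atom_eq_comp_cell:
  assumes t: "ra_atom B t"
  obtains x y h where "(x, y) \<in> linked" "h \<in> arr x x" "t = h \<^bold>; cell x y"
proof -
  have tc: "t \<in> carrier B" using t by (rule atom_closed)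
  obtain p q where pq: "(p, q) \<in> \<theta> t" using atom_nonempty[OF t] by auto
  then have pqE: "(p, q) \<in> E" using rep_subset[OF tc] by blast
  obtain x where x: "x \<in> ids" "p \<in> pts x" using pts_cover E_U[OF pqE] by blast
  obtain y where y: "y \<in> ids" "q \<in> pts y" using pts_cover E_U[OF pqE] by blast
  have xy: "(x, y) \<in> linked" using x y pqE unfolding linked_def by blast
  have ta: "t \<in> arr x y" using arrI[OF t pq x(2) y(2) x(1) y(1)] .
  obtain w where w: "(b x, w) \<in> \<theta> t" using arr_total[OF ta x(1) base_pts[OF x(1)]] .
  then have "w \<in> pts y" "(b x, w) \<in> E" using arr_pts[OF ta] rep_subset[OF tc] by auto
  then obtain v where v: "(v, w) \<in> \<theta> (cell x y)" using arr_onto[OF cell(2)[OF xy] y(1)] by blast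
  have c: "cell x y \<in> carrier B" using cell(2)[OF xy] by (rule arr_closed)
  have "v \<in> pts x" "(v, w) \<in> E" using v arr_pts[OF cell(2)[OF xy]] rep_subset[OF c] by auto
  moreover have "(b x, v) \<in> E" using E_trans[OF \<open>(b x, w) \<in> E\<close> E_sym[OF \<open>(v, w) \<in> E\<close>]] .
  ultimately obtain h where h: "h \<in> arr x x" "(b x, v) \<in> \<theta> h"
    using ex_arr base_pts x(1) by metis
  have "(b x, w) \<in> \<theta> (h \<^bold>; cell x y)" using h v c arr_closed[OF h(1)] by auto
  then have "t = h \<^bold>; cell x y"
    using w t by (intro atom_eq) (auto intro: arr_atom arr_comp_left h cell xy x y)
  then show thesis using that xy h by blast
qed

lemma frame_rels_eq:
  "{frame_rel frame x y \<alpha> | x y \<alpha>. (x, y) \<in> ieq frame \<and> \<alpha> \<in> carrier (grp frame x Mod Hsub frame x y)}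
    = (\<lambda>t. pull (\<theta> t)) ` {t. ra_atom B t}" (is "?L = ?R")
proof (intro equalityI subsetI)
  fix R assume "R \<in> ?L"
  then obtain x y h where xy: "(x, y) \<in> linked" and h: "h \<in> arr x x"
    and R: "R = frame_rel frame x y (kern x y #>\<^bsub>arr_group x\<^esub> h)"
    by (auto simp: frame_simps FactGroup_def RCOSETS_def)
  have "ra_atom B (h \<^bold>; cell x y)"
    using arr_atom[OF arr_comp_left[OF h cell(2)[OF xy]]] linked_ids[OF xy] by blast
  then show "R \<in> ?R" using R frame_rel_eq_pull[OF xy h] by blast
next
  fix R assume "R \<in> ?R"
  then obtain t where t: "ra_atom B t" "R = pull (\<theta> t)" by blast
  obtain x y h where xy: "(x, y) \<in> linked" and h: "h \<in> arr x x" "t = h \<^bold>; cell x y"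
    using atom_eq_comp_cell[OF t(1)] .
  have "kern x y #>\<^bsub>arr_group x\<^esub> h \<in> carrier (arr_group x Mod kern x y)"
    using h by (auto simp: FactGroup_def RCOSETS_def)
  then show "R \<in> ?L"
    using t(2) h xy frame_rel_eq_pull[OF xy h(1)] unfolding frame_simps by blast
qed

lemma pull_unit: "pull E = frame_unit frame"
proof (intro equalityI subrelI)
  fix f g assume "(f, g) \<in> pull E"
  then obtain x y v w where x: "x \<in> ids" "f \<in> arr x x" "(b x, v) \<in> \<theta> f"
    and y: "y \<in> ids" "g \<in> arr y y" "(b y, w) \<in> \<theta> g" and vw: "(v, w) \<in> E"
    by (auto simp: pull_def orb_def)
  have "(x, y) \<in> linked"
    using x y vw arr_pts[OF x(2,3)] arr_pts[OF y(2,3)] unfolding linked_def by blast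
  then show "(f, g) \<in> frame_unit frame"
    using x y by (auto simp: frame_unit_def frame_simps)
next
  fix f g assume "(f, g) \<in> frame_unit frame"
  then obtain x y where xy: "(x, y) \<in> linked" and f: "f \<in> arr x x" and g: "g \<in> arr y y"
    by (auto simp: frame_unit_def frame_simps)
  note I = linked_ids[OF xy, THEN conjunct1] linked_ids[OF xy, THEN conjunct2]
  obtain v where v: "(f, v) \<in> orb" "(b x, v) \<in> E" using orb_total[OF I(1) f] by blast
  obtain w where w: "(g, w) \<in> orb" "(b y, w) \<in> E" using orb_total[OF I(2) g] by blast
  \<comment> \<open>The two points are connected through their base points.\<close>
  have "(v, w) \<in> E"
    using E_trans[OF E_sym[OF v(2)] E_trans[OF base_linked[OF xy] w(2)]] .
  then show "(f, g) \<in> pull E" using v w by (auto simp: pull_def)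
qed

text \<open>A pair of group elements names only one pair of points, since \<open>orb\<close> is
  single-valued.\<close>

lemma pull_diff: "pull (R - S) = pull R - pull S"
  unfolding pull_def using orb_function by blast

text \<open>As \<open>R\<close> lies in \<open>E\<close>, the intermediate point of a composite has
  a name by \<open>orb_closed\<close>; conversely, a shared group element names a single
  point.\<close>

lemma pull_comp:
  assumes "R \<subseteq> E" shows "pull (R O S) = pull R O pull S"
proof (intro equalityI subrelI)
  fix f h assume "(f, h) \<in> pull (R O S)"
  then obtain v w u where vwu: "(f, v) \<in> orb" "(h, u) \<in> orb" "(v, w) \<in> R" "(w, u) \<in> S"
    by (auto simp: pull_def)
  obtain g where "(g, w) \<in> orb" using orb_closed[OF vwu(1)] vwu(3) assms by blast
  with vwu show "(f, h) \<in> pull R O pull S" by (auto simp: pull_def)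
next
  fix f h assume "(f, h) \<in> pull R O pull S"
  then obtain g v w w' u where "(f, v) \<in> orb" "(g, w) \<in> orb" "(v, w) \<in> R"
    "(g, w') \<in> orb" "(h, u) \<in> orb" "(w', u) \<in> S"
    by (auto simp: pull_def)
  moreover from this have "w' = w" using orb_function by blast
  ultimately show "(f, h) \<in> pull (R O S)" by (auto simp: pull_def)
qed

lemma pull_Id: "pull (Id_on U) = Id_on (frame_base frame)"
proof (intro equalityI subrelI)
  fix f g assume "(f, g) \<in> pull (Id_on U)"
  then obtain v where v: "(f, v) \<in> orb" "(g, v) \<in> orb" by (auto simp: pull_def)
  then have "f = g" by (rule orb_injective)
  then show "(f, g) \<in> Id_on (frame_base frame)"
    using v by (auto simp: frame_base_def frame_simps orb_def)
next
  fix f g assume "(f, g) \<in> Id_on (frame_base frame)"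
  then obtain x where x: "x \<in> ids" "f \<in> arr x x" "f = g"
    by (auto simp: frame_base_def frame_simps)
  obtain v where "(f, v) \<in> orb" "v \<in> U" using orb_total[OF x(1,2)] pts_U[OF x(1)] by blast
  then show "(f, g) \<in> pull (Id_on U)" using x by (auto simp: pull_def)
qed

lemma pull_UN: "pull (\<Union>t\<in>X. \<theta> t) = (\<Union>t\<in>X. pull (\<theta> t))"
  by (auto simp: pull_def)

text \<open>Restriction to the range of \<open>orb\<close> loses no atom, because every arrow from
  \<open>x\<close> is defined at the base point \<open>b x\<close>; injectivity of the final
  isomorphism rests on this.\<close>

lemma pull_atom_nonempty:
  assumes t: "ra_atom B t" shows "pull (\<theta> t) \<noteq> {}"
proof -
  obtain x y h where xy: "(x, y) \<in> linked" and h: "h \<in> arr x x" "t = h \<^bold>; cell x y"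
    using atom_eq_comp_cell[OF t] .
  note I = linked_ids[OF xy, THEN conjunct1] linked_ids[OF xy, THEN conjunct2]
  have ta: "t \<in> arr x y" using h arr_comp_left[OF h(1) cell(2)[OF xy] I] by simp
  obtain w where w: "(b x, w) \<in> \<theta> t" using arr_total[OF ta I(1) base_pts[OF I(1)]] .
  \<comment> \<open>The identity \<open>x\<close> of the group names the base point itself.\<close>
  have "(x, b x) \<in> orb"
    using I base_pts by (simp add: orb_iff ids_arr rep_ids Id_on_iff)
  moreover obtain g where "(g, w) \<in> orb"
    using orb_closed[OF calculation] w rep_subset[OF atom_closed[OF t]] by blast
  ultimately show ?thesis using w by (auto simp: pull_def)
qed

text \<open>The isomorphism is the representation of sets of atoms followed by
  \<open>pull\<close>.\<close>

lemma atom_alg_isomorphic: "ra_isomorphic (atom_alg B) (group_rel_alg frame)"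
proof -
  define k where "k X = pull (\<Union>t\<in>X. \<theta> t)" for X
  have rep: "(\<lambda>X. \<Union>t\<in>X. \<theta> t) \<in> ra_hom (atom_alg B) (full_set_rel_alg U E)"
    using atom_alg_embedding by (simp add: ra_embedding_def)
  have image: "k ` Pow {t. ra_atom B t} = carrier (group_rel_alg frame)"
  proof -
    have "carrier (group_rel_alg frame) = {\<Union> S | S. S \<subseteq> (\<lambda>t. pull (\<theta> t)) ` {t. ra_atom B t}}"
      unfolding group_rel_alg_def frame_rels_eq by simp
    then show ?thesis
      unfolding k_def pull_UN by (auto simp: subset_image_iff)
  qed
  have "k \<in> ra_hom (atom_alg B) (group_rel_alg frame)"
    unfolding ra_hom_def mem_Collect_eq
  proof (intro conjI ballI)
    show "k \<in> carrier (atom_alg B) \<rightarrow> carrier (group_rel_alg frame)"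
      using image by (auto simp: atom_alg_def)
    show "k (X \<^bold>+\<^bsub>atom_alg B\<^esub> Y) = k X \<^bold>+\<^bsub>group_rel_alg frame\<^esub> k Y" for X Y
      by (auto simp: k_def pull_def atom_alg_def group_rel_alg_def)
    fix X assume X: "X \<in> carrier (atom_alg B)"
    show "k (\<^bold>-\<^bsub>atom_alg B\<^esub> X) = \<^bold>-\<^bsub>group_rel_alg frame\<^esub> k X"
      using rep X unfolding ra_hom_def
      by (simp add: k_def group_rel_alg_def full_set_rel_alg_def pull_diff pull_unit)
    show "k (X\<^sup>\<smile>\<^bsub>atom_alg B\<^esub>) = (k X)\<^sup>\<smile>\<^bsub>group_rel_alg frame\<^esub>"
      using rep X unfolding ra_hom_def
      by (auto simp: k_def group_rel_alg_def full_set_rel_alg_def pull_def)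
    fix Y assume Y: "Y \<in> carrier (atom_alg B)"
    have "(\<Union>t\<in>X. \<theta> t) \<subseteq> E"
      using rep X by (auto simp: ra_hom_def full_set_rel_alg_def)
    then show "k (X \<^bold>;\<^bsub>atom_alg B\<^esub> Y) = k X \<^bold>;\<^bsub>group_rel_alg frame\<^esub> k Y"
      using rep X Y unfolding ra_hom_def
      by (simp add: k_def group_rel_alg_def full_set_rel_alg_def pull_comp)
  next
    show "k \<^bold>1'\<^bsub>atom_alg B\<^esub> = \<^bold>1'\<^bsub>group_rel_alg frame\<^esub>"
      using rep unfolding ra_hom_def
      by (simp add: k_def group_rel_alg_def full_set_rel_alg_def pull_Id)
  qed
  moreover have "inj_on k (carrier (atom_alg B))"
  proof
    have *: "X \<subseteq> Y" if X: "X \<subseteq> {a. ra_atom B a}" and Y: "Y \<subseteq> {a. ra_atom B a}" and eq: "k X = k Y" for X Y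
    proof
      fix s assume s: "s \<in> X"
      then have sa: "ra_atom B s" using X by blast
      obtain f g where fg: "(f, g) \<in> pull (\<theta> s)" using pull_atom_nonempty[OF sa] by auto
      then have "(f, g) \<in> k X" using s unfolding k_def pull_UN by blast
      then have "(f, g) \<in> k Y" by (simp add: eq)
      then obtain t where t: "t \<in> Y" "(f, g) \<in> pull (\<theta> t)" unfolding k_def pull_UN by blast
      have ta: "ra_atom B t" using t Y by blast
      \<comment> \<open>\<open>(f, g)\<close> names one pair of points, which lies in both
        images.\<close>
      obtain p where "p \<in> \<theta> s" "p \<in> \<theta> t"
        using fg t(2) orb_function unfolding pull_def by blast
      then show "s \<in> Y" using atom_eq[OF sa ta] t(1) by blast
    qed
    fix X Y assume "X \<in> carrier (atom_alg B)" "Y \<in> carrier (atom_alg B)" "k X = k Y"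
    then show "X = Y" using *[of X Y] *[of Y X] by (simp add: atom_alg_def)
  qed
  ultimately show ?thesis
    using image unfolding ra_isomorphic_def bij_betw_def by (auto simp: atom_alg_def)
qed

end

text \<open>The group elements are atoms of \<open>B\<close>, so the frame lives over the type of
  \<open>B\<close>. The existence clause is witnessed by the complex algebra of atoms; the universal
  clause covers completions on any type.\<close>

theorem corollary7p7:
  fixes B :: "'a rel_alg"
  assumes "measurable_rel_alg B"
    and "\<exists>(U :: 'u set) E \<theta>. complete_representation B U E \<theta>"
  shows "\<exists>F :: ('a, 'a) group_pair. is_frame F
    \<and> (\<exists>C :: 'a set rel_alg. is_completion B C \<and> ra_isomorphic C (group_rel_alg F))
    \<and> (\<forall>C :: 'c rel_alg. is_completion B C \<longrightarrow> ra_isomorphic C (group_rel_alg F))"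
proof -
  obtain U :: "'u set" and E \<theta> where rep: "complete_representation B U E \<theta>"
    using assms(2) by blast
  have RA: "relation_algebra B" using assms(1) by (simp add: measurable_rel_alg_def)
  interpret measurable_representation B U E \<theta>
    by (intro measurable_representation.intro measurable_representation_axioms.intro RA assms(1) rep)
  obtain b where b: "\<forall>x\<in>ids. b x \<in> pts x" "\<forall>(x, y)\<in>linked. (b x, b y) \<in> E"
    using ex_base_points by blast
  interpret based_representation B U E \<theta> b
    by (intro based_representation.intro based_representation_axioms.intro
        measurable_representation_axioms) (use b in auto)
  show ?thesis
    using is_frame_frame atom_alg_isomorphic
      atom_alg_is_completion[OF RA atomic_B relation_algebra_atom_alg]
      completion_isomorphic_atom_alg[OF RA atomic_B] ra_isomorphic_trans
    by (intro exI[of _ frame]) blast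
qed

end
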